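(* Let $p$ be an odd prime, and let $H$ be the group given in the variety $\mathcal N_{2,p}$ by the presentation $$H=\langle \{x_i\}_{i\in\mathbb N},\, \{z_k\}_{k\in\mathbb N^+} \;:\; [x_i,x_k]=z_k \ \ (0\le i<k)\rangle .$$ Then $H$ is word automatic.
   Context: $\mathbb N=\{0,1,2,\dots\}$, $\mathbb N^+=\{1,2,\dots\}$ and $[x,y]=x^{-1}y^{-1}xy$. $\mathcal N_{2,p}$ is the variety of groups satisfying the laws $[[x,y],z]=1$ and $x^p=1$. A presentation in the variety $\mathcal N_{2,p}$ denotes the quotient of the free group of $\mathcal N_{2,p}$ on the listed generators by the normal subgroup generated by the listed relations. Convolution: let $\Sigma$ be a finite alphabet and $\Diamond\notin\Sigma$ a filler symbol. For $\sigma_1,\dots,\sigma_n\in\Sigma^*$, extend each string on the right by symbols $\Diamond$ to the common length $\max_i|\sigma_i|$, and stack the resulting strings on top of each other to obtain a single string over the alphabet $(\Sigma\cup\{\Diamond\})^n$. A relation $S\subseteq(\Sigma^* )^n$ is FA-recognizable if the set of convolutions of its tuples is a regular language over $(\Sigma\cup\{\Diamond\})^n$. Word automatic: a group $G$ is word automatic (FA-presentable) if there are a finite alphabet $\Sigma$, a regular language $D\subseteq\Sigma^*$ and a surjection $\pi:D\to G$ (elements may be represented by more than one string) such that the relations $\{(\sigma,\tau)\in D^2:\pi(\sigma)=\pi(\tau)\}$ and $\{(\sigma,\tau,\rho)\in D^3:\pi(\sigma)\pi(\tau)=\pi(\rho)\}$ are FA-recognizable. (This is not the notion of automatic group in the sense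 of Thurston and Epstein.) *)

theory Defs
  imports "HOL-Algebra.Generated_Groups" "HOL-Computational_Algebra.Primes"
begin

text \<open>Recognition by a complete deterministic finite automaton. Only finitely many states
  occur, so taking them to be natural numbers is no restriction.\<close>

definition regular :: "'a set \<Rightarrow> 'a list set \<Rightarrow> bool" where
  "regular A L \<longleftrightarrow>
     (\<exists>(Q :: nat set) q0 F \<delta>. finite Q \<and> q0 \<in> Q \<and> F \<subseteq> Q \<and> (\<forall>q\<in>Q. \<forall>a\<in>A. \<delta> q a \<in> Q) \<and>
        L = {w \<in> lists A. foldl \<delta> q0 w \<in> F})"

text \<open>A tuple of strings is a list of strings. A letter of the convolution is a column, that is,
  a list whose length is the arity, over \<open>'a option\<close>; \<open>None\<close> is the filler symbol.\<close>

definition convolution :: "'a list list \<Rightarrow> 'a option list list" where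
  "convolution ws =
     map (\<lambda>j. map (\<lambda>w. if j < length w then Some (w ! j) else None) ws)
       [0..<foldr max (map length ws) 0]"

definition columns :: "'a set \<Rightarrow> nat \<Rightarrow> 'a option list set" where
  "columns \<Sigma> n = {c. length c = n \<and> set c \<subseteq> insert None (Some ` \<Sigma>)}"

definition fa_recognizable :: "'a set \<Rightarrow> nat \<Rightarrow> 'a list list set \<Rightarrow> bool" where
  "fa_recognizable \<Sigma> n S \<longleftrightarrow>
     S \<subseteq> {ws. length ws = n \<and> set ws \<subseteq> lists \<Sigma>} \<and> regular (columns \<Sigma> n) (convolution ` S)"

text \<open>Every finite alphabet is in bijection with a finite set of natural numbers, so letters are
  taken to be natural numbers.\<close>

definition word_automatic :: "('a, 'b) monoid_scheme \<Rightarrow> bool" where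
  "word_automatic G \<longleftrightarrow> group G \<and>
     (\<exists>(\<Sigma> :: nat set) D \<pi>. finite \<Sigma> \<and> regular \<Sigma> D \<and> \<pi> ` D = carrier G \<and>
        fa_recognizable \<Sigma> 2 {[s, t] | s t. s \<in> D \<and> t \<in> D \<and> \<pi> s = \<pi> t} \<and>
        fa_recognizable \<Sigma> 3
          {[s, t, r] | s t r. s \<in> D \<and> t \<in> D \<and> r \<in> D \<and> \<pi> s \<otimes>\<^bsub>G\<^esub> \<pi> t = \<pi> r})"

text \<open>The pair \<open>(x, True)\<close> stands for the generator \<open>x\<close> and \<open>(x, False)\<close> for its inverse.
  Two words are equivalent if they are connected by insertions and deletions of factors
  \<open>x x\<^sup>-\<^sup>1\<close> and \<open>x\<^sup>-\<^sup>1 x\<close>.\<close>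

definition group_words :: "'g set \<Rightarrow> ('g \<times> bool) list set" where
  "group_words S = lists (S \<times> UNIV)"

definition cancels :: "'g set \<Rightarrow> (('g \<times> bool) list \<times> ('g \<times> bool) list) set" where
  "cancels S = {(u @ [(x, b), (x, \<not> b)] @ v, u @ v) | u v x b.
     u \<in> group_words S \<and> v \<in> group_words S \<and> x \<in> S}"

definition word_equiv :: "'g set \<Rightarrow> (('g \<times> bool) list \<times> ('g \<times> bool) list) set" where
  "word_equiv S = (cancels S \<union> (cancels S)\<inverse>)\<^sup>* \<inter> group_words S \<times> group_words S"

definition free_group :: "'g set \<Rightarrow> ('g \<times> bool) list set monoid" where
  "free_group S = \<lparr>
     carrier = group_words S // word_equiv S,
     monoid.mult = (\<lambda>A B. \<Union>a\<in>A. \<Union>b\<in>B. word_equiv S `` {a @ b}),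
     one = word_equiv S `` {[]}\<rparr>"

definition free_gen :: "'g set \<Rightarrow> 'g \<Rightarrow> ('g \<times> bool) list set" where
  "free_gen S x = word_equiv S `` {[(x, True)]}"

definition commutator :: "('a, 'b) monoid_scheme \<Rightarrow> 'a \<Rightarrow> 'a \<Rightarrow> 'a" where
  "commutator G x y = inv\<^bsub>G\<^esub> x \<otimes>\<^bsub>G\<^esub> inv\<^bsub>G\<^esub> y \<otimes>\<^bsub>G\<^esub> x \<otimes>\<^bsub>G\<^esub> y"

text \<open>The verbal subgroup of the laws \<open>[[x,y],z] = 1\<close> and \<open>x\<^sup>p = 1\<close>; it is normal since the
  set of values of the laws is closed under conjugation.\<close>

definition N2p_verbal :: "nat \<Rightarrow> ('a, 'b) monoid_scheme \<Rightarrow> 'a set" where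
  "N2p_verbal p G = generate G
     ({commutator G (commutator G x y) z | x y z. x \<in> carrier G \<and> y \<in> carrier G \<and> z \<in> carrier G} \<union>
      {x [^]\<^bsub>G\<^esub> p | x. x \<in> carrier G})"

definition N2p_free_group :: "nat \<Rightarrow> 'g set \<Rightarrow> ('g \<times> bool) list set set monoid" where
  "N2p_free_group p S = free_group S Mod N2p_verbal p (free_group S)"

definition N2p_free_gen :: "nat \<Rightarrow> 'g set \<Rightarrow> 'g \<Rightarrow> ('g \<times> bool) list set set" where
  "N2p_free_gen p S x = N2p_verbal p (free_group S) #>\<^bsub>free_group S\<^esub> free_gen S x"

definition normal_closure :: "('a, 'b) monoid_scheme \<Rightarrow> 'a set \<Rightarrow> 'a set" where
  "normal_closure G R = \<Inter>{N. N \<lhd> G \<and> R \<subseteq> N}"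

text \<open>A pair \<open>(u, v)\<close> in \<open>R\<close> is the relation \<open>u = v\<close> between elements of the relatively free group
  on \<open>S\<close>.\<close>

definition N2p_presented ::
  "nat \<Rightarrow> 'g set \<Rightarrow> (('g \<times> bool) list set set \<times> ('g \<times> bool) list set set) set \<Rightarrow>
   ('g \<times> bool) list set set set monoid" where
  "N2p_presented p S R = N2p_free_group p S Mod
     normal_closure (N2p_free_group p S)
       {u \<otimes>\<^bsub>N2p_free_group p S\<^esub> inv\<^bsub>N2p_free_group p S\<^esub> v | u v. (u, v) \<in> R}"

datatype generator = Xgen nat | Zgen nat

definition H_gens :: "generator set" where
  "H_gens = {Xgen i | i. True} \<union> {Zgen k | k. k \<ge> 1}"

definition H_group :: "nat \<Rightarrow> (generator \<times> bool) list set set set monoid" where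
  "H_group p = N2p_presented p H_gens
     {(commutator (N2p_free_group p H_gens)
         (N2p_free_gen p H_gens (Xgen i)) (N2p_free_gen p H_gens (Xgen k)),
       N2p_free_gen p H_gens (Zgen k)) | i k. i < k}"

end

theory Submission
  imports Defs
begin

text \<open>With \<open>z\<^sub>0 = 1\<close>, every element of \<open>H\<close> is an ordered product \<open>\<Prod>\<^sub>i x\<^sub>i\<^sup>a\<^sup>i z\<^sub>i\<^sup>b\<^sup>i\<close>
  with digits modulo \<open>p\<close>. Since \<open>x\<^sub>k x\<^sub>i = x\<^sub>i x\<^sub>k z\<^sub>k\<^sup>-\<^sup>1\<close> for \<open>i < k\<close>, the digits of a product are
  \<open>a\<^sub>k + a'\<^sub>k\<close> and \<open>b\<^sub>k + b'\<^sub>k - a\<^sub>k (a'\<^sub>0 + \<dots> + a'\<^sub>k\<^sub>-\<^sub>1)\<close>, so an automaton that reads the digits from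
  left to right only has to remember a partial sum modulo \<open>p\<close>. That distinct digits give distinct elements
  is seen in the Heisenberg group modulo \<open>p\<close>: mapping \<open>x\<^sub>i\<close> to \<open>x\<close> for \<open>i < k\<close>, to \<open>y\<close> for \<open>i = k\<close> and to
  \<open>1\<close> for \<open>i > k\<close> respects the relations.\<close>

section \<open>Recognition of relations by local checks\<close>

text \<open>Two normal forms are never multiplied by collection. Collection is carried out only for
  one generator times a normal form, which shows that every element has digits; the digits of a
  product, known to exist, are then read off in the Heisenberg group, where multiplication is
  explicit. As there is no generator z_0, the homomorphisms exist only for k > 0, so a_0 is
  recovered from the first entry for k = 1, and b_0 is disregarded everywhere. Oddness of p enters
  because the Heisenberg group modulo p has exponent p only then. Strings of different lengths cause
  no trouble for the automata: every digit condition holds by itself where all strings have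
  ended.\<close>

text \<open>An injection of the finite state set into the natural numbers renames the states, so
  automata may use options, sets and pairs as states.\<close>

lemma regularI:
  fixes Q :: "'q set"
  assumes fin: "finite Q" and q0: "q0 \<in> Q" and step: "\<And>q a. q \<in> Q \<Longrightarrow> a \<in> A \<Longrightarrow> \<delta> q a \<in> Q"
  shows "regular A {w \<in> lists A. foldl \<delta> q0 w \<in> F}"
proof -
  from finite_imp_inj_to_nat_seg[OF fin] obtain e :: "'q \<Rightarrow> nat" where e: "inj_on e Q"
    by blast
  define d where "d = inv_into Q e"
  have d: "d (e q) = q" if "q \<in> Q" for q
    using that e by (simp add: d_def)
  define \<delta>' where "\<delta>' m a = e (\<delta> (d m) a)" for m a
  have run: "foldl \<delta>' (e q) w = e (foldl \<delta> q w) \<and> foldl \<delta> q w \<in> Q"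
    if "q \<in> Q" "w \<in> lists A" for q w
    using that
  proof (induction w arbitrary: q)
    case (Cons a w)
    then show ?case by (simp add: \<delta>'_def d step)
  qed simp
  have "e x \<in> e ` (F \<inter> Q) \<longleftrightarrow> x \<in> F" if "x \<in> Q" for x
    using that inj_on_image_mem_iff[OF e that, of "F \<inter> Q"] by auto
  then have "{w \<in> lists A. foldl \<delta> q0 w \<in> F} =
      {w \<in> lists A. foldl \<delta>' (e q0) w \<in> e ` (F \<inter> Q)}"
    using run[OF q0] by (intro Collect_cong conj_cong refl) metis
  moreover have "\<forall>q\<in>e ` Q. \<forall>a\<in>A. \<delta>' q a \<in> e ` Q"
    by (auto simp: \<delta>'_def d step)
  ultimately show ?thesis
    unfolding regular_def using fin q0
    by (intro exI[of _ "e ` Q"] exI[of _ "e q0"] exI[of _ "e ` (F \<inter> Q)"] exI[of _ \<delta>']) auto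
qed

lemma regular_lists: "regular A (lists A)"
  using regularI[of "{()}" "()" A "\<lambda>_ _. ()" UNIV] by simp

lemma regular_Int:
  assumes "regular A L" and "regular A M"
  shows "regular A (L \<inter> M)"
proof -
  obtain Q :: "nat set" and q0 F \<delta> where Q: "finite Q" "q0 \<in> Q" "\<And>q a. q \<in> Q \<Longrightarrow> a \<in> A \<Longrightarrow> \<delta> q a \<in> Q"
    and L: "L = {w \<in> lists A. foldl \<delta> q0 w \<in> F}"
    using assms(1) unfolding regular_def by metis
  obtain Q' :: "nat set" and q0' F' \<delta>'
    where Q': "finite Q'" "q0' \<in> Q'" "\<And>q a. q \<in> Q' \<Longrightarrow> a \<in> A \<Longrightarrow> \<delta>' q a \<in> Q'"
      and M: "M = {w \<in> lists A. foldl \<delta>' q0' w \<in> F'}"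
    using assms(2) unfolding regular_def by metis
  have "foldl (\<lambda>(q, r) a. (\<delta> q a, \<delta>' r a)) (q, r) w = (foldl \<delta> q w, foldl \<delta>' r w)" for q r w
    by (induction w arbitrary: q r) auto
  then have "L \<inter> M =
      {w \<in> lists A. foldl (\<lambda>(q, r) a. (\<delta> q a, \<delta>' r a)) (q0, q0') w \<in> F \<times> F'}"
    unfolding L M by auto
  moreover have "regular A \<dots>"
    using Q Q' by (intro regularI[where Q = "Q \<times> Q'"]) auto
  ultimately show ?thesis by simp
qed

text \<open>A dead state \<open>None\<close>, entered at the first failed check, turns a condition
  on all prefixes into an acceptance condition. The check sees the state reached before the letter,
  and the letter.\<close>

lemma regular_local_check:
  fixes Q :: "'q set"
  assumes "finite Q" and "q0 \<in> Q" and "\<And>q a. q \<in> Q \<Longrightarrow> a \<in> A \<Longrightarrow> \<delta> q a \<in> Q"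
  shows "regular A {w \<in> lists A. \<forall>k<length w. ok (foldl \<delta> q0 (take k w)) (w ! k)}"
proof -
  define \<delta>' where "\<delta>' s a = (case s of None \<Rightarrow> None
      | Some q \<Rightarrow> if ok q a then Some (\<delta> q a) else None)" for s a
  have None: "foldl \<delta>' None w = None" for w
    by (induction w) (simp_all add: \<delta>'_def)
  have "foldl \<delta>' (Some q) w \<noteq> None \<longleftrightarrow> (\<forall>k<length w. ok (foldl \<delta> q (take k w)) (w ! k))" for q w
  proof (induction w arbitrary: q)
    case (Cons a w)
    show ?case
    proof (cases "ok q a")
      case True
      then have "foldl \<delta>' (Some q) (a # w) = foldl \<delta>' (Some (\<delta> q a)) w"
        by (simp add: \<delta>'_def)
      moreover have "(\<forall>k<length (a # w). ok (foldl \<delta> q (take k (a # w))) ((a # w) ! k)) \<longleftrightarrow>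
          (\<forall>k<length w. ok (foldl \<delta> (\<delta> q a) (take k w)) (w ! k))"
        using True by (simp add: All_less_Suc2)
      ultimately show ?thesis using Cons.IH by simp
    next
      case False
      then have "foldl \<delta>' (Some q) (a # w) = None"
        using None by (simp add: \<delta>'_def)
      then show ?thesis using False by (auto simp: All_less_Suc2)
    qed
  qed simp
  then have "{w \<in> lists A. \<forall>k<length w. ok (foldl \<delta> q0 (take k w)) (w ! k)} =
      {w \<in> lists A. foldl \<delta>' (Some q0) w \<in> - {None}}"
    by auto
  moreover have "regular A \<dots>"
    using assms by (intro regularI[where Q = "insert None (Some ` Q)"]) (auto simp: \<delta>'_def)
  ultimately show ?thesis by simp
qed

section \<open>Convolutions as a regular language\<close>

definition column :: "'a list list \<Rightarrow> nat \<Rightarrow> 'a option list" where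
  "column ws j = map (\<lambda>w. if j < length w then Some (w ! j) else None) ws"

definition max_length :: "'a list list \<Rightarrow> nat" where
  "max_length ws = foldr max (map length ws) 0"

lemma convolution_eq: "convolution ws = map (column ws) [0..<max_length ws]"
  by (simp add: convolution_def column_def max_length_def)

lemma less_max_length_iff: "j < max_length ws \<longleftrightarrow> (\<exists>i<length ws. j < length (ws ! i))"
proof -
  have "j < max_length ws \<longleftrightarrow> (\<exists>w\<in>set ws. j < length w)"
    unfolding max_length_def by (induction ws) (auto simp: less_max_iff_disj)
  then show ?thesis
    by (metis in_set_conv_nth)
qed

lemma column_in_columns:
  assumes "length ws = n" and "set ws \<subseteq> lists \<Sigma>"
  shows "column ws j \<in> columns \<Sigma> n"
proof -
  have "w ! j \<in> \<Sigma>" if "w \<in> set ws" "j < length w" for w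
    using that assms(2) by (metis in_listsD nth_mem subsetD)
  then show ?thesis
    using assms(1) by (auto simp: column_def columns_def)
qed

definition nones :: "'a option list \<Rightarrow> nat set" where
  "nones c = {i. i < length c \<and> c ! i = None}"

lemma nones_column: "nones (column ws j) = {i. i < length ws \<and> length (ws ! i) \<le> j}"
  by (auto simp: nones_def column_def split: if_splits)

text \<open>The acceptance condition of the automaton that remembers the set of ended rows.\<close>

definition padded_from :: "nat set \<Rightarrow> 'a option list list \<Rightarrow> bool" where
  "padded_from E w \<longleftrightarrow> (\<forall>k<length w. (if k = 0 then E else nones (w ! (k - 1))) \<subseteq> nones (w ! k)
      \<and> nones (w ! k) \<noteq> {..<length (w ! k)})"

lemma padded_from_Cons:
  "padded_from E (c # w) \<longleftrightarrow> E \<subseteq> nones c \<and> nones c \<noteq> {..<length c} \<and> padded_from (nones c) w"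
proof -
  have "(c # w) ! k = (if k = 0 then c else w ! (k - 1))" for k
    by (simp add: nth_Cons')
  then show ?thesis
    unfolding padded_from_def by (simp add: All_less_Suc2 del: nth_Cons_Suc)
qed

text \<open>A row that shows the filler in \<open>c\<close> has ended, so its remainder must be
  empty. If \<open>c\<close> showed only fillers, the tuple would consist of empty strings, and its
  convolution would be empty instead of starting with \<open>c\<close>.\<close>

lemma convolution_Cons:
  assumes len: "length vs = length c" and E: "\<And>i. i \<in> nones c \<Longrightarrow> vs ! i = []"
    and all: "nones c \<noteq> {..<length c}"
  shows "convolution (map2 (\<lambda>a v. case a of None \<Rightarrow> [] | Some x \<Rightarrow> x # v) c vs) = c # convolution vs"
proof -
  define ws where "ws = map2 (\<lambda>a v. case a of None \<Rightarrow> [] | Some x \<Rightarrow> x # v) c vs"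
  have lw: "length ws = length c" by (simp add: ws_def len)
  have nth: "ws ! i = (case c ! i of None \<Rightarrow> [] | Some x \<Rightarrow> x # vs ! i)" if "i < length c" for i
    using that len by (simp add: ws_def)
  have emp: "vs ! i = []" if "i < length c" "c ! i = None" for i
    using that E by (simp add: nones_def)
  have col0: "column ws 0 = c"
    by (rule nth_equalityI) (auto simp: column_def lw nth split: option.splits)
  have colS: "column ws (Suc j) = column vs j" for j
    by (rule nth_equalityI) (auto simp: column_def lw len nth emp split: option.splits)
  have "nones c \<subset> {..<length c}"
    using all by (auto simp: nones_def)
  then obtain i where "i \<in> {..<length c} - nones c"
    by blast
  then have i: "i < length c" "c ! i \<noteq> None"
    by (simp_all add: nones_def)
  have "max_length ws = Suc (max_length vs)"
  proof -
    have "j < max_length ws \<longleftrightarrow> j < Suc (max_length vs)" for j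
    proof (cases j)
      case 0
      have "0 < length (ws ! i)" using i nth by auto
      then have "0 < max_length ws" unfolding less_max_length_iff using i lw by auto
      then show ?thesis using 0 by simp
    next
      case (Suc k)
      have "(Suc k < length (ws ! i)) = (k < length (vs ! i))" if "i < length c" for i
        using that by (auto simp: nth emp split: option.splits)
      then have "Suc k < max_length ws \<longleftrightarrow> k < max_length vs"
        unfolding less_max_length_iff lw len by (simp cong: conj_cong)
      then show ?thesis using Suc by simp
    qed
    from this[of "max_length ws"] this[of "Suc (max_length vs)"] show ?thesis by simp
  qed
  then have "convolution ws = map (column ws) [0..<Suc (max_length vs)]"
    by (simp add: convolution_eq)
  also have "\<dots> = c # convolution vs"
    by (simp del: upt_Suc add: upt_conv_Cons col0 convolution_eq map_Suc_upt[symmetric] colS comp_def)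
  finally show ?thesis by (simp add: ws_def)
qed

text \<open>The set \<open>E\<close> of rows that ended earlier is generalized in the induction; the
  conclusion that these rows are empty is what \<open>convolution_Cons\<close> requires of the
  remaining tuple.\<close>

lemma convolution_exists:
  assumes "w \<in> lists (columns \<Sigma> n)" and "padded_from E w" and "E \<subseteq> {..<n}"
  shows "\<exists>ws. length ws = n \<and> set ws \<subseteq> lists \<Sigma> \<and> (\<forall>i\<in>E. ws ! i = []) \<and> convolution ws = w"
  using assms
proof (induction w arbitrary: E rule: list.induct)
  case Nil
  have "convolution (replicate n []) = []"
    using less_max_length_iff[of 0 "replicate n []"] by (auto simp: convolution_eq)
  then show ?case
    using Nil by (intro exI[of _ "replicate n []"]) auto
next
  case (Cons c w)
  then have c: "c \<in> columns \<Sigma> n" and w: "w \<in> lists (columns \<Sigma> n)" by auto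
  then have lc: "length c = n" by (simp add: columns_def)
  have pad: "E \<subseteq> nones c" "nones c \<noteq> {..<length c}" "padded_from (nones c) w"
    using Cons.prems(2) by (simp_all add: padded_from_Cons)
  obtain vs where vs: "length vs = n" "set vs \<subseteq> lists \<Sigma>" "\<forall>i\<in>nones c. vs ! i = []"
      "convolution vs = w"
    using Cons.IH[OF w pad(3)] lc by (auto simp: nones_def)
  define ws where "ws = map2 (\<lambda>a v. case a of None \<Rightarrow> [] | Some x \<Rightarrow> x # v) c vs"
  have "convolution ws = c # w"
    unfolding ws_def using vs lc pad(2) by (subst convolution_Cons) auto
  moreover have "ws ! i = []" if "i \<in> E" for i
    using that pad(1) lc vs(1) by (auto simp: ws_def nones_def)
  moreover have "set ws \<subseteq> lists \<Sigma>"
  proof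
    fix u assume "u \<in> set ws"
    then obtain i where i: "i < n" "u = (case c ! i of None \<Rightarrow> [] | Some x \<Rightarrow> x # vs ! i)"
      using lc vs(1) by (auto simp: ws_def set_conv_nth)
    have "c ! i \<in> insert None (Some ` \<Sigma>)"
      using c i(1) lc nth_mem[of i c] unfolding columns_def by blast
    moreover have "vs ! i \<in> lists \<Sigma>" using vs(1,2) i(1) nth_mem by blast
    ultimately show "u \<in> lists \<Sigma>" using i(2) by (auto split: option.splits)
  qed
  ultimately show ?case
    using lc vs(1) by (intro exI[of _ ws]) (auto simp: ws_def)
qed

lemma convolution_image:
  "convolution ` {ws. length ws = n \<and> set ws \<subseteq> lists \<Sigma>} =
     {w \<in> lists (columns \<Sigma> n). padded_from {} w}"
proof (intro equalityI subsetI)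
  fix w assume "w \<in> convolution ` {ws. length ws = n \<and> set ws \<subseteq> lists \<Sigma>}"
  then obtain ws where ws: "length ws = n" "set ws \<subseteq> lists \<Sigma>" "w = convolution ws" by auto
  have "w \<in> lists (columns \<Sigma> n)"
    using ws by (auto simp: convolution_eq intro!: column_in_columns)
  moreover have "padded_from {} w"
    unfolding padded_from_def
  proof (intro allI impI)
    fix k assume "k < length w"
    then have k: "k < max_length ws" by (simp add: ws(3) convolution_eq)
    then have wk: "w ! j = column ws j" if "j \<le> k" for j
      using that by (simp add: ws(3) convolution_eq)
    obtain i where "i < length ws" "k < length (ws ! i)"
      using k by (auto simp: less_max_length_iff)
    then have "i \<in> {..<length (w ! k)} - nones (w ! k)"
      by (simp add: wk nones_column) (simp add: column_def)
    then have "nones (w ! k) \<noteq> {..<length (w ! k)}"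
      by blast
    then show "(if k = 0 then {} else nones (w ! (k - 1))) \<subseteq> nones (w ! k)
      \<and> nones (w ! k) \<noteq> {..<length (w ! k)}"
      by (auto simp: wk nones_column)
  qed
  ultimately show "w \<in> {w \<in> lists (columns \<Sigma> n). padded_from {} w}" by simp
next
  fix w assume "w \<in> {w \<in> lists (columns \<Sigma> n). padded_from {} w}"
  then show "w \<in> convolution ` {ws. length ws = n \<and> set ws \<subseteq> lists \<Sigma>}"
    using convolution_exists[of w \<Sigma> n "{}"] by force
qed

text \<open>Being a convolution constrains only adjacent columns: ended rows stay ended, and some
  row is still running. It is enough to remember the filler positions of the last column.\<close>

lemma regular_convolution_image:
  "regular (columns \<Sigma> n) (convolution ` {ws. length ws = n \<and> set ws \<subseteq> lists \<Sigma>})"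
proof -
  have last: "foldl (\<lambda>_. nones) E (take k w) = (if k = 0 then E else nones (w ! (k - 1)))"
    if "k < length w" for k E and w :: "'a option list list"
    using that by (cases k) (simp_all add: take_Suc_conv_app_nth)
  define ok where "ok E c \<longleftrightarrow> E \<subseteq> nones c \<and> nones c \<noteq> {..<length c}" for E and c :: "'a option list"
  have "{w \<in> lists (columns \<Sigma> n). padded_from {} w} =
    {w \<in> lists (columns \<Sigma> n). \<forall>k<length w. ok (foldl (\<lambda>_. nones) {} (take k w)) (w ! k)}"
    unfolding padded_from_def ok_def by (simp add: last cong: conj_cong imp_cong)
  moreover have "regular (columns \<Sigma> n) \<dots>"
    by (intro regular_local_check[where Q = "Pow {..<n}"]) (auto simp: nones_def columns_def)
  ultimately show ?thesis unfolding convolution_image by simp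
qed

lemma fa_recognizable_local_check:
  fixes Q :: "'q set"
  assumes Q: "finite Q" "q0 \<in> Q" "\<And>q c. q \<in> Q \<Longrightarrow> c \<in> columns \<Sigma> n \<Longrightarrow> \<delta> q c \<in> Q"
  shows "fa_recognizable \<Sigma> n {ws. length ws = n \<and> set ws \<subseteq> lists \<Sigma> \<and>
    (\<forall>k<max_length ws. ok (foldl \<delta> q0 (map (column ws) [0..<k])) (column ws k))}"
    (is "fa_recognizable \<Sigma> n ?S")
proof -
  \<comment> \<open>The check depends on \<open>ws\<close> only through its convolution, so
    restricting the tuples amounts to intersecting their convolutions with the strings that
    pass.\<close>
  have "convolution ` ?S =
    convolution ` {ws. length ws = n \<and> set ws \<subseteq> lists \<Sigma>} \<inter>
    {w \<in> lists (columns \<Sigma> n). \<forall>k<length w. ok (foldl \<delta> q0 (take k w)) (w ! k)}" (is "?L = ?R")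
  proof -
    have eq: "(\<forall>k<length (convolution ws). ok (foldl \<delta> q0 (take k (convolution ws))) (convolution ws ! k)) \<longleftrightarrow>
      (\<forall>k<max_length ws. ok (foldl \<delta> q0 (map (column ws) [0..<k])) (column ws k))" for ws :: "'a list list"
      by (simp add: convolution_eq take_map)
    have "convolution ws \<in> lists (columns \<Sigma> n)" if "length ws = n" "set ws \<subseteq> lists \<Sigma>" for ws :: "'a list list"
      using that by (auto simp: convolution_eq intro!: column_in_columns)
    then show ?thesis using eq by blast
  qed
  moreover have "regular (columns \<Sigma> n) ?R"
    by (intro regular_Int regular_convolution_image regular_local_check[OF Q]) auto
  ultimately show ?thesis unfolding fa_recognizable_def by auto
qed

section \<open>Free groups and presentations\<close>

lemma equiv_word_equiv: "equiv (group_words S) (word_equiv S)"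
proof (rule equivI)
  show "word_equiv S \<subseteq> group_words S \<times> group_words S" "refl_on (group_words S) (word_equiv S)"
    by (auto simp: word_equiv_def refl_on_def)
  have "sym ((cancels S \<union> (cancels S)\<inverse>)\<^sup>*)"
    by (intro sym_rtrancl sym_Un_converse)
  then show "sym (word_equiv S)"
    by (auto simp: word_equiv_def sym_def)
  show "trans (word_equiv S)"
    unfolding word_equiv_def by (intro trans_Int trans_rtrancl) (auto simp: trans_def)
qed

lemma group_words_append [simp]: "u @ v \<in> group_words S \<longleftrightarrow> u \<in> group_words S \<and> v \<in> group_words S"
  by (auto simp: group_words_def)

lemma group_words_Nil [simp]: "[] \<in> group_words S"
  by (simp add: group_words_def)

lemma group_words_Cons [simp]: "a # v \<in> group_words S \<longleftrightarrow> fst a \<in> S \<and> v \<in> group_words S"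
  by (cases a) (auto simp: group_words_def)

lemma cancels_context:
  assumes "(u, v) \<in> cancels S" and "a \<in> group_words S" and "b \<in> group_words S"
  shows "(a @ u @ b, a @ v @ b) \<in> cancels S"
proof -
  obtain c d x e where "u = c @ [(x, e), (x, \<not> e)] @ d" "v = c @ d"
      "c \<in> group_words S" "d \<in> group_words S" "x \<in> S"
    using assms(1) unfolding cancels_def by blast
  with assms(2,3) show ?thesis
    unfolding cancels_def by (intro CollectI exI[of _ "a @ c"] exI[of _ "d @ b"]) auto
qed

lemma word_equiv_context:
  assumes "(u, v) \<in> word_equiv S" and "a \<in> group_words S" and "b \<in> group_words S"
  shows "(a @ u @ b, a @ v @ b) \<in> word_equiv S"
proof -
  have "(u, v) \<in> (cancels S \<union> (cancels S)\<inverse>)\<^sup>*"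
    using assms(1) by (simp add: word_equiv_def)
  then have "(a @ u @ b, a @ v @ b) \<in> (cancels S \<union> (cancels S)\<inverse>)\<^sup>*"
  proof induction
    case (step v w)
    then have "(a @ v @ b, a @ w @ b) \<in> cancels S \<union> (cancels S)\<inverse>"
      using cancels_context assms(2,3) by blast
    with step.IH show ?case by (rule rtrancl_into_rtrancl)
  qed simp
  with assms show ?thesis by (simp add: word_equiv_def)
qed

lemma word_equiv_append:
  assumes "(u, u') \<in> word_equiv S" and "(v, v') \<in> word_equiv S"
  shows "(u @ v, u' @ v') \<in> word_equiv S"
proof -
  have "u' \<in> group_words S" "v \<in> group_words S"
    using assms by (auto simp: word_equiv_def)
  then have "(u @ v, u' @ v) \<in> word_equiv S" "(u' @ v, u' @ v') \<in> word_equiv S"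
    using word_equiv_context[OF assms(1), of "[]" v] word_equiv_context[OF assms(2), of u' "[]"]
    by simp_all
  then show ?thesis
    using equiv_word_equiv[of S] by (meson equivE transD)
qed

definition free_class :: "'g set \<Rightarrow> ('g \<times> bool) list \<Rightarrow> ('g \<times> bool) list set" where
  "free_class S w = word_equiv S `` {w}"

lemma carrier_free_group: "carrier (free_group S) = free_class S ` group_words S"
  by (auto simp: free_group_def free_class_def quotient_def)

lemma one_free_group: "\<one>\<^bsub>free_group S\<^esub> = free_class S []"
  by (simp add: free_group_def free_class_def)

lemma mult_free_group:
  assumes "u \<in> group_words S" and "v \<in> group_words S"
  shows "free_class S u \<otimes>\<^bsub>free_group S\<^esub> free_class S v = free_class S (u @ v)"
proof -
  have "congruent2 (word_equiv S) (word_equiv S) (\<lambda>a b. word_equiv S `` {a @ b})"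
    by (intro congruent2I[OF equiv_word_equiv equiv_word_equiv] equiv_class_eq[OF equiv_word_equiv] word_equiv_append)
      (auto simp: word_equiv_def)
  from UN_equiv_class2[OF equiv_word_equiv equiv_word_equiv this assms] show ?thesis
    by (simp add: free_group_def free_class_def)
qed

lemma free_class_inverse:
  assumes "w \<in> group_words S"
  shows "free_class S (rev (map (\<lambda>(x, b). (x, \<not> b)) w)) \<otimes>\<^bsub>free_group S\<^esub> free_class S w = \<one>\<^bsub>free_group S\<^esub>"
proof -
  let ?inv = "\<lambda>w. rev (map (\<lambda>(x, b). (x, \<not> b)) w)"
  have iw: "?inv w \<in> group_words S" if "w \<in> group_words S" for w
    using that by (auto simp: group_words_def)
  have "(?inv w @ w, []) \<in> word_equiv S"
    using assms
  proof (induction w rule: list.induct)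
    case (Cons a w)
    obtain x b where a: "a = (x, b)" by (cases a)
    \<comment> \<open>The innermost pair cancels; the flag \<open>b\<close> is written as a double
      negation to match the shape of \<open>cancels\<close> with first flag
      \<open>\<not> b\<close>.\<close>
    have "(?inv w @ [(x, \<not> b), (x, \<not> \<not> b)] @ w, ?inv w @ w) \<in> cancels S"
      using Cons.prems a iw[of w] unfolding cancels_def
      by (intro CollectI exI[of _ "?inv w"] exI[of _ w] exI[of _ x] exI[of _ "\<not> b"]) auto
    then have "(?inv (a # w) @ a # w, ?inv w @ w) \<in> word_equiv S"
      using Cons.prems iw unfolding word_equiv_def a by auto
    with Cons show ?case
      using equiv_word_equiv[of S] by (meson equivE transD group_words_Cons)
  qed (simp add: word_equiv_def)
  then have "free_class S (?inv w @ w) = free_class S []"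
    unfolding free_class_def by (rule equiv_class_eq[OF equiv_word_equiv])
  then show ?thesis
    using assms iw by (simp add: mult_free_group one_free_group)
qed

lemma group_free_group: "group (free_group S)"
proof (rule groupI)
  fix x assume "x \<in> carrier (free_group S)"
  then obtain w where w: "w \<in> group_words S" "x = free_class S w"
    by (auto simp: carrier_free_group)
  then have "rev (map (\<lambda>(x, b). (x, \<not> b)) w) \<in> group_words S"
    by (auto simp: group_words_def)
  then show "\<exists>y\<in>carrier (free_group S). y \<otimes>\<^bsub>free_group S\<^esub> x = \<one>\<^bsub>free_group S\<^esub>"
    using free_class_inverse[OF w(1)] w(2) by (auto simp: carrier_free_group)
qed (auto simp: carrier_free_group one_free_group mult_free_group)

lemma free_gen_closed: "x \<in> S \<Longrightarrow> free_gen S x \<in> carrier (free_group S)"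
  by (simp add: carrier_free_group free_gen_def free_class_def[symmetric])

lemma inv_free_gen:
  assumes "x \<in> S"
  shows "inv\<^bsub>free_group S\<^esub> free_gen S x = free_class S [(x, False)]"
proof -
  interpret group "free_group S" by (rule group_free_group)
  have "free_class S [(x, False)] \<otimes>\<^bsub>free_group S\<^esub> free_gen S x = \<one>\<^bsub>free_group S\<^esub>"
    using free_class_inverse[of "[(x, True)]" S] assms by (simp add: free_gen_def free_class_def)
  then show ?thesis
    using assms by (intro inv_equality free_gen_closed) (simp_all add: carrier_free_group)
qed

text \<open>Letters of a representative word are peeled off from the left. The rule is transferred
  below along both quotient maps, so that generation of the quotients can be used without
  words.\<close>

lemma free_group_induct [consumes 1, case_names one gen inv_gen]:
  assumes "h \<in> carrier (free_group S)"
    and one: "P \<one>\<^bsub>free_group S\<^esub>"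
    and gen: "\<And>x h. x \<in> S \<Longrightarrow> h \<in> carrier (free_group S) \<Longrightarrow> P h \<Longrightarrow>
      P (free_gen S x \<otimes>\<^bsub>free_group S\<^esub> h)"
    and inv_gen: "\<And>x h. x \<in> S \<Longrightarrow> h \<in> carrier (free_group S) \<Longrightarrow> P h \<Longrightarrow>
      P (inv\<^bsub>free_group S\<^esub> free_gen S x \<otimes>\<^bsub>free_group S\<^esub> h)"
  shows "P h"
proof -
  have "P (free_class S w)" if "w \<in> group_words S" for w
    using that
  proof (induction w rule: list.induct)
    case Nil
    then show ?case using one by (simp add: one_free_group)
  next
    case (Cons a w)
    then obtain x b where a: "a = (x, b)" "x \<in> S" "w \<in> group_words S"
      by (cases a) auto
    then have "free_class S (a # w) = free_class S [(x, b)] \<otimes>\<^bsub>free_group S\<^esub> free_class S w"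
      by (simp add: mult_free_group)
    moreover have "free_class S [(x, True)] = free_gen S x"
      by (simp add: free_gen_def free_class_def)
    ultimately show ?case
      using gen[OF a(2) _ Cons.IH] inv_gen[OF a(2) _ Cons.IH] a inv_free_gen[OF a(2)]
      by (cases b) (auto simp: carrier_free_group)
  qed
  with assms(1) show ?thesis by (auto simp: carrier_free_group)
qed

section \<open>Evaluation of words and the universal property\<close>

primrec word_eval :: "('a, 'b) monoid_scheme \<Rightarrow> ('g \<Rightarrow> 'a) \<Rightarrow> ('g \<times> bool) list \<Rightarrow> 'a" where
  "word_eval G f [] = \<one>\<^bsub>G\<^esub>"
| "word_eval G f (a # w) =
     (if snd a then f (fst a) else inv\<^bsub>G\<^esub> f (fst a)) \<otimes>\<^bsub>G\<^esub> word_eval G f w"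

context group
begin

lemma word_eval_closed:
  assumes "\<And>x. x \<in> S \<Longrightarrow> f x \<in> carrier G" and "w \<in> group_words S"
  shows "word_eval G f w \<in> carrier G"
  using assms(2) by (induction w rule: list.induct) (simp_all add: assms(1))

lemma word_eval_append:
  assumes "\<And>x. x \<in> S \<Longrightarrow> f x \<in> carrier G" and "u \<in> group_words S" and "v \<in> group_words S"
  shows "word_eval G f (u @ v) = word_eval G f u \<otimes> word_eval G f v"
  using assms(2)
  by (induction u rule: list.induct) (simp_all add: m_assoc word_eval_closed[where f = f and S = S, OF assms(1)] assms)

lemma word_eval_word_equiv:
  assumes f: "\<And>x. x \<in> S \<Longrightarrow> f x \<in> carrier G" and "(u, v) \<in> word_equiv S"
  shows "word_eval G f u = word_eval G f v"
proof -
  have cancel: "word_eval G f u = word_eval G f v" if "(u, v) \<in> cancels S" for u v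
  proof -
    obtain c d x e where uv: "u = c @ [(x, e), (x, \<not> e)] @ d" "v = c @ d"
      and cd: "c \<in> group_words S" "d \<in> group_words S" "x \<in> S"
      using \<open>(u, v) \<in> cancels S\<close> unfolding cancels_def by auto
    have "word_eval G f [(x, e), (x, \<not> e)] = \<one>"
      using f[OF cd(3)] by simp
    then have "word_eval G f ([(x, e), (x, \<not> e)] @ d) = word_eval G f d"
      using cd word_eval_closed[where f = f and S = S, OF f] by (subst word_eval_append[where f = f and S = S, OF f]) auto
    then show ?thesis
      unfolding uv using cd word_eval_append[where f = f and S = S, OF f] by simp
  qed
  have "(u, v) \<in> (cancels S \<union> (cancels S)\<inverse>)\<^sup>*"
    using assms(2) by (simp add: word_equiv_def)
  then show ?thesis
    by induction (auto dest: cancel)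
qed

lemma free_group_universal:
  assumes f: "\<And>x. x \<in> S \<Longrightarrow> f x \<in> carrier G"
  obtains h where "h \<in> hom (free_group S) G" and "\<And>x. x \<in> S \<Longrightarrow> h (free_gen S x) = f x"
proof
  define h where "h A = word_eval G f (SOME w. w \<in> A)" for A
  have h: "h (free_class S w) = word_eval G f w" if "w \<in> group_words S" for w
  proof -
    have "w \<in> free_class S w"
      using that by (simp add: free_class_def word_equiv_def)
    then have "(w, SOME w'. w' \<in> free_class S w) \<in> word_equiv S"
      by (metis Image_singleton_iff free_class_def someI)
    then show ?thesis
      unfolding h_def using word_eval_word_equiv[where f = f and S = S, OF f] by metis
  qed
  show "h \<in> hom (free_group S) G"
    by (rule homI)
      (auto simp: carrier_free_group mult_free_group h word_eval_closed[where f = f and S = S, OF f] word_eval_append[where f = f and S = S, OF f])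
  show "h (free_gen S x) = f x" if "x \<in> S" for x
    using that h[of "[(x, True)]"] f[OF that] by (simp add: free_gen_def free_class_def)
qed

lemma commutator_closed [simp]:
  "x \<in> carrier G \<Longrightarrow> y \<in> carrier G \<Longrightarrow> commutator G x y \<in> carrier G"
  by (simp add: commutator_def)

text \<open>With [x,y] = x^-1 y^-1 x y the commutator is (yx)^-1 (xy). In this form a commutator
  relation is a rule for interchanging two factors.\<close>

lemma commutator_eq_iff:
  assumes "x \<in> carrier G" "y \<in> carrier G" "c \<in> carrier G"
  shows "commutator G x y = c \<longleftrightarrow> x \<otimes> y = y \<otimes> x \<otimes> c"
proof -
  have "commutator G x y = inv (y \<otimes> x) \<otimes> (x \<otimes> y)"
    using assms by (simp add: commutator_def inv_mult_group m_assoc)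
  then show ?thesis
    using assms by (metis inv_solve_left m_closed)
qed

end

lemma (in group_hom) hom_commutator:
  assumes "x \<in> carrier G" "y \<in> carrier G"
  shows "h (commutator G x y) = commutator H (h x) (h y)"
  using assms by (simp add: commutator_def)

section \<open>The laws of the variety and its free groups\<close>

definition in_N2p :: "nat \<Rightarrow> ('a, 'b) monoid_scheme \<Rightarrow> bool" where
  "in_N2p p G \<longleftrightarrow> group G \<and> (\<forall>x\<in>carrier G. x [^]\<^bsub>G\<^esub> p = \<one>\<^bsub>G\<^esub>) \<and>
     (\<forall>x\<in>carrier G. \<forall>y\<in>carrier G. \<forall>z\<in>carrier G.
        commutator G (commutator G x y) z = \<one>\<^bsub>G\<^esub>)"

text \<open>Homomorphisms commute with forming values of the laws, and every element of
  \<open>K\<close> has a preimage. This serves both the quotient by the verbal subgroup and the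
  later quotient of a group already in the variety.\<close>

lemma in_N2p_hom_image:
  assumes "group_hom G K h" and "h ` carrier G = carrier K"
    and "\<And>x. x \<in> carrier G \<Longrightarrow> h (x [^]\<^bsub>G\<^esub> p) = \<one>\<^bsub>K\<^esub>"
    and "\<And>x y z. x \<in> carrier G \<Longrightarrow> y \<in> carrier G \<Longrightarrow> z \<in> carrier G \<Longrightarrow>
      h (commutator G (commutator G x y) z) = \<one>\<^bsub>K\<^esub>"
  shows "in_N2p p K"
proof -
  interpret group_hom G K h by fact
  have "h x [^]\<^bsub>K\<^esub> p = \<one>\<^bsub>K\<^esub>" if "x \<in> carrier G" for x
    using that assms(3) by (simp add: hom_nat_pow)
  moreover have "commutator K (commutator K (h x) (h y)) (h z) = \<one>\<^bsub>K\<^esub>"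
    if "x \<in> carrier G" "y \<in> carrier G" "z \<in> carrier G" for x y z
    using that assms(4)[OF that] by (simp add: hom_commutator)
  ultimately show ?thesis
    using H.group_axioms unfolding in_N2p_def assms(2)[symmetric] by blast
qed

lemma (in group) N2p_verbal_normal: "N2p_verbal p G \<lhd> G"
  unfolding N2p_verbal_def
proof (rule normal_generateI)
  fix h g
  assume h: "h \<in> {commutator G (commutator G x y) z | x y z. x \<in> carrier G \<and> y \<in> carrier G \<and> z \<in> carrier G} \<union>
      {x [^] p | x. x \<in> carrier G}" and g: "g \<in> carrier G"
  \<comment> \<open>Conjugation by \<open>g\<close> is an endomorphism, and endomorphisms map values
    of a law to values of the same law.\<close>
  define c where "c x = g \<otimes> x \<otimes> inv g" for x
  interpret c: group_hom G G c
  proof (unfold_locales, rule homI)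
    fix x y assume "x \<in> carrier G" "y \<in> carrier G"
    then show "c (x \<otimes> y) = c x \<otimes> c y"
      using g by (simp add: c_def m_assoc) (simp add: m_assoc[symmetric])
  qed (use g in \<open>simp add: c_def\<close>)
  have "c h \<in> {commutator G (commutator G x y) z | x y z. x \<in> carrier G \<and> y \<in> carrier G \<and> z \<in> carrier G} \<union>
      {x [^] p | x. x \<in> carrier G}"
    using h
  proof
    assume "h \<in> {commutator G (commutator G x y) z | x y z. x \<in> carrier G \<and> y \<in> carrier G \<and> z \<in> carrier G}"
    then obtain x y z where "h = commutator G (commutator G x y) z" "x \<in> carrier G" "y \<in> carrier G" "z \<in> carrier G"
      by blast
    then show ?thesis
      by (intro UnI1 CollectI exI[of _ "c x"] exI[of _ "c y"] exI[of _ "c z"]) (simp add: c.hom_commutator)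
  next
    assume "h \<in> {x [^] p | x. x \<in> carrier G}"
    then obtain x where "h = x [^] p" "x \<in> carrier G"
      by blast
    then show ?thesis
      by (intro UnI2 CollectI exI[of _ "c x"]) (simp add: c.hom_nat_pow)
  qed
  then show "g \<otimes> h \<otimes> inv g \<in> {commutator G (commutator G x y) z | x y z. x \<in> carrier G \<and> y \<in> carrier G \<and> z \<in> carrier G} \<union>
      {x [^] p | x. x \<in> carrier G}"
    by (simp add: c_def)
qed auto

lemma (in group_hom) N2p_verbal_subset_kernel:
  assumes "in_N2p p H"
  shows "N2p_verbal p G \<subseteq> kernel G H h"
  unfolding N2p_verbal_def
proof (rule G.generate_subgroup_incl[OF _ subgroup_kernel])
  show "{commutator G (commutator G x y) z | x y z. x \<in> carrier G \<and> y \<in> carrier G \<and> z \<in> carrier G} \<union>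
      {x [^]\<^bsub>G\<^esub> p | x. x \<in> carrier G} \<subseteq> kernel G H h"
    using assms by (auto simp: kernel_def in_N2p_def hom_commutator hom_nat_pow)
qed

lemma (in group) normal_closure_normal:
  assumes "R \<subseteq> carrier G"
  shows "normal_closure G R \<lhd> G"
  unfolding normal_inv_iff
proof (intro conjI ballI)
  \<comment> \<open>The intersected family contains the whole group and so is not empty; this is
    where \<open>R\<close> must lie in the carrier.\<close>
  have ne: "carrier G \<in> {N. N \<lhd> G \<and> R \<subseteq> N}"
    using assms normal_self by simp
  then show "subgroup (normal_closure G R) G"
    unfolding normal_closure_def by (intro subgroups_Inter) (auto simp: normal_imp_subgroup)
  show "x \<otimes> h \<otimes> inv x \<in> normal_closure G R" if "x \<in> carrier G" "h \<in> normal_closure G R" for x h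
    using that unfolding normal_closure_def by (auto simp: normal_inv_iff)
qed

lemma subset_normal_closure: "R \<subseteq> normal_closure G R"
  by (auto simp: normal_closure_def)

lemma normal_closure_subset: "N \<lhd> G \<Longrightarrow> R \<subseteq> N \<Longrightarrow> normal_closure G R \<subseteq> N"
  by (auto simp: normal_closure_def)

lemma (in normal) group_hom_Mod: "group_hom G (G Mod H) (\<lambda>a. H #> a)"
  by (intro group_hom.intro group_hom_axioms.intro group_axioms factorgroup_is_group r_coset_hom_Mod)

lemma (in normal) r_coset_eq_one_iff:
  assumes "a \<in> carrier G"
  shows "H #> a = \<one>\<^bsub>G Mod H\<^esub> \<longleftrightarrow> a \<in> H"
  unfolding one_FactGroup by (metis assms coset_join1 coset_join2 subgroup_axioms)

lemma in_N2p_N2p_free_group: "in_N2p p (N2p_free_group p S)"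
proof -
  interpret F: group "free_group S" by (rule group_free_group)
  interpret N: normal "N2p_verbal p (free_group S)" "free_group S" by (rule F.N2p_verbal_normal)
  show ?thesis
    unfolding N2p_free_group_def
  proof (rule in_N2p_hom_image[OF N.group_hom_Mod])
    show "(\<lambda>a. N2p_verbal p (free_group S) #>\<^bsub>free_group S\<^esub> a) ` carrier (free_group S)
      = carrier (free_group S Mod N2p_verbal p (free_group S))"
      by (simp add: carrier_FactGroup)
  next
    fix x assume x: "x \<in> carrier (free_group S)"
    then have "x [^]\<^bsub>free_group S\<^esub> p \<in> N2p_verbal p (free_group S)"
      unfolding N2p_verbal_def by (blast intro: generate.incl)
    then show "N2p_verbal p (free_group S) #>\<^bsub>free_group S\<^esub> x [^]\<^bsub>free_group S\<^esub> p
      = \<one>\<^bsub>free_group S Mod N2p_verbal p (free_group S)\<^esub>"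
      using x N.r_coset_eq_one_iff by blast
  next
    fix x y z assume xyz: "x \<in> carrier (free_group S)" "y \<in> carrier (free_group S)" "z \<in> carrier (free_group S)"
    then have "commutator (free_group S) (commutator (free_group S) x y) z \<in> N2p_verbal p (free_group S)"
      unfolding N2p_verbal_def by (blast intro: generate.incl)
    then show "N2p_verbal p (free_group S) #>\<^bsub>free_group S\<^esub> commutator (free_group S) (commutator (free_group S) x y) z
      = \<one>\<^bsub>free_group S Mod N2p_verbal p (free_group S)\<^esub>"
      using xyz N.r_coset_eq_one_iff by simp
  qed
qed

lemma N2p_free_gen_closed: "x \<in> S \<Longrightarrow> N2p_free_gen p S x \<in> carrier (N2p_free_group p S)"
  by (simp add: N2p_free_group_def N2p_free_gen_def carrier_FactGroup free_gen_closed)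

lemma N2p_free_group_universal:
  assumes G: "in_N2p p G" and f: "\<And>x. x \<in> S \<Longrightarrow> f x \<in> carrier G"
  obtains h where "h \<in> hom (N2p_free_group p S) G"
    and "\<And>x. x \<in> S \<Longrightarrow> h (N2p_free_gen p S x) = f x"
proof -
  interpret group G using G by (simp add: in_N2p_def)
  interpret F: group "free_group S" by (rule group_free_group)
  obtain h where h: "h \<in> hom (free_group S) G" "\<And>x. x \<in> S \<Longrightarrow> h (free_gen S x) = f x"
    using free_group_universal[where f = f and S = S, OF f] by blast
  interpret h: group_hom "free_group S" G h
    by unfold_locales (fact h(1))
  obtain g where g: "g \<in> hom (free_group S Mod N2p_verbal p (free_group S)) G"
    "\<And>x. x \<in> carrier (free_group S) \<Longrightarrow> g (N2p_verbal p (free_group S) #>\<^bsub>free_group S\<^esub> x) = h x"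
    using h.FactGroup_universal_kernel[OF F.N2p_verbal_normal h.N2p_verbal_subset_kernel[OF G]] by blast
  show thesis
    using g h(2) by (intro that[of g]) (auto simp: N2p_free_group_def N2p_free_gen_def free_gen_closed)
qed

lemma N2p_free_group_induct [consumes 1, case_names one gen inv_gen]:
  assumes "h \<in> carrier (N2p_free_group p S)"
    and one: "P \<one>\<^bsub>N2p_free_group p S\<^esub>"
    and gen: "\<And>x h. x \<in> S \<Longrightarrow> h \<in> carrier (N2p_free_group p S) \<Longrightarrow> P h \<Longrightarrow>
      P (N2p_free_gen p S x \<otimes>\<^bsub>N2p_free_group p S\<^esub> h)"
    and inv_gen: "\<And>x h. x \<in> S \<Longrightarrow> h \<in> carrier (N2p_free_group p S) \<Longrightarrow> P h \<Longrightarrow>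
      P (inv\<^bsub>N2p_free_group p S\<^esub> N2p_free_gen p S x \<otimes>\<^bsub>N2p_free_group p S\<^esub> h)"
  shows "P h"
proof -
  interpret F: group "free_group S" by (rule group_free_group)
  interpret N: normal "N2p_verbal p (free_group S)" "free_group S" by (rule F.N2p_verbal_normal)
  interpret q: group_hom "free_group S" "N2p_free_group p S"
    "\<lambda>a. N2p_verbal p (free_group S) #>\<^bsub>free_group S\<^esub> a"
    unfolding N2p_free_group_def by (rule N.group_hom_Mod)
  obtain a where a: "a \<in> carrier (free_group S)" "h = N2p_verbal p (free_group S) #>\<^bsub>free_group S\<^esub> a"
    using assms(1) by (auto simp: N2p_free_group_def carrier_FactGroup)
  from a(1) have "P (N2p_verbal p (free_group S) #>\<^bsub>free_group S\<^esub> a)"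
  proof (induction a rule: free_group_induct)
    case one
    then show ?case using \<open>P \<one>\<^bsub>N2p_free_group p S\<^esub>\<close> by (metis q.hom_one)
  next
    case (gen x b)
    then show ?case
      using assms(3)[OF gen(1) q.hom_closed[OF gen(2)] gen(3)] q.hom_mult[OF free_gen_closed gen(2)]
      by (simp add: N2p_free_gen_def)
  next
    case (inv_gen x b)
    then show ?case
      using assms(4)[OF inv_gen(1) q.hom_closed[OF inv_gen(2)] inv_gen(3)]
        q.hom_mult[OF F.inv_closed[OF free_gen_closed] inv_gen(2)] q.hom_inv[OF free_gen_closed]
      by (simp add: N2p_free_gen_def)
  qed
  with a(2) show ?thesis by simp
qed

section \<open>Groups presented in the variety\<close>

definition relators where
  "relators p S R = normal_closure (N2p_free_group p S)
     {u \<otimes>\<^bsub>N2p_free_group p S\<^esub> inv\<^bsub>N2p_free_group p S\<^esub> v | u v. (u, v) \<in> R}"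

definition presented_class where
  "presented_class p S R u = relators p S R #>\<^bsub>N2p_free_group p S\<^esub> u"

lemma N2p_presented_eq: "N2p_presented p S R = N2p_free_group p S Mod relators p S R"
  by (simp add: N2p_presented_def relators_def)

context
  fixes p :: nat and S :: "'g set" and R
  assumes R: "R \<subseteq> carrier (N2p_free_group p S) \<times> carrier (N2p_free_group p S)"
begin

interpretation F: group "N2p_free_group p S"
  using in_N2p_N2p_free_group[of p S] by (simp add: in_N2p_def)

lemma relator_closed:
  "{u \<otimes>\<^bsub>N2p_free_group p S\<^esub> inv\<^bsub>N2p_free_group p S\<^esub> v | u v. (u, v) \<in> R}
     \<subseteq> carrier (N2p_free_group p S)"
  using R by auto

interpretation N: normal "relators p S R" "N2p_free_group p S"
  unfolding relators_def by (intro F.normal_closure_normal relator_closed)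

lemma group_hom_presented_class:
  "group_hom (N2p_free_group p S) (N2p_presented p S R) (presented_class p S R)"
  using N.group_hom_Mod unfolding N2p_presented_eq presented_class_def[abs_def] .

interpretation q: group_hom "N2p_free_group p S" "N2p_presented p S R" "presented_class p S R"
  by (rule group_hom_presented_class)

lemma presented_class_surj:
  "presented_class p S R ` carrier (N2p_free_group p S) = carrier (N2p_presented p S R)"
  by (simp add: N2p_presented_eq presented_class_def carrier_FactGroup)

lemma in_N2p_N2p_presented: "in_N2p p (N2p_presented p S R)"
  using in_N2p_N2p_free_group[of p S]
  by (intro in_N2p_hom_image[OF group_hom_presented_class presented_class_surj])
    (simp_all add: in_N2p_def)

lemma presented_class_relation:
  assumes "(u, v) \<in> R"
  shows "presented_class p S R u = presented_class p S R v"
proof -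
  have uv: "u \<in> carrier (N2p_free_group p S)" "v \<in> carrier (N2p_free_group p S)"
    using assms R by auto
  have "u \<otimes>\<^bsub>N2p_free_group p S\<^esub> inv\<^bsub>N2p_free_group p S\<^esub> v \<in> relators p S R"
    unfolding relators_def by (rule subsetD[OF subset_normal_closure]) (use assms in blast)
  then have "presented_class p S R (u \<otimes>\<^bsub>N2p_free_group p S\<^esub> inv\<^bsub>N2p_free_group p S\<^esub> v)
    = \<one>\<^bsub>N2p_presented p S R\<^esub>"
    using uv by (simp add: presented_class_def N2p_presented_eq N.r_coset_eq_one_iff del: one_FactGroup)
  then have "presented_class p S R u \<otimes>\<^bsub>N2p_presented p S R\<^esub>
      inv\<^bsub>N2p_presented p S R\<^esub> presented_class p S R v = \<one>\<^bsub>N2p_presented p S R\<^esub>"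
    using uv by simp
  moreover have "presented_class p S R u = presented_class p S R u \<otimes>\<^bsub>N2p_presented p S R\<^esub>
      inv\<^bsub>N2p_presented p S R\<^esub> presented_class p S R v
      \<otimes>\<^bsub>N2p_presented p S R\<^esub> presented_class p S R v"
    using uv by (simp add: q.H.m_assoc)
  ultimately show ?thesis
    using uv by simp
qed

text \<open>Von Dyck's theorem inside the variety: a map respecting the relations sends each u v^-1
  to 1, and its kernel, being normal, contains the normal closure.\<close>

lemma N2p_presented_universal:
  assumes G: "in_N2p p G" and h: "h \<in> hom (N2p_free_group p S) G"
    and rel: "\<And>u v. (u, v) \<in> R \<Longrightarrow> h u = h v"
  obtains g where "g \<in> hom (N2p_presented p S R) G"
    and "\<And>u. u \<in> carrier (N2p_free_group p S) \<Longrightarrow> g (presented_class p S R u) = h u"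
proof -
  interpret group G using G by (simp add: in_N2p_def)
  interpret h: group_hom "N2p_free_group p S" G h
    by unfold_locales (fact h)
  have "h (u \<otimes>\<^bsub>N2p_free_group p S\<^esub> inv\<^bsub>N2p_free_group p S\<^esub> v) = \<one>\<^bsub>G\<^esub>" if "(u, v) \<in> R" for u v
    using that rel[OF that] R by auto
  then have "{u \<otimes>\<^bsub>N2p_free_group p S\<^esub> inv\<^bsub>N2p_free_group p S\<^esub> v | u v. (u, v) \<in> R}
     \<subseteq> kernel (N2p_free_group p S) G h"
    using relator_closed unfolding kernel_def by blast
  then have "relators p S R \<subseteq> kernel (N2p_free_group p S) G h"
    unfolding relators_def by (intro normal_closure_subset h.normal_kernel)
  from h.FactGroup_universal_kernel[OF N.normal_axioms this] show thesis
    using that unfolding N2p_presented_eq presented_class_def by blast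
qed

lemma N2p_presented_induct [consumes 1, case_names one gen inv_gen]:
  assumes "h \<in> carrier (N2p_presented p S R)"
    and one: "P \<one>\<^bsub>N2p_presented p S R\<^esub>"
    and gen: "\<And>x h. x \<in> S \<Longrightarrow> h \<in> carrier (N2p_presented p S R) \<Longrightarrow> P h \<Longrightarrow>
      P (presented_class p S R (N2p_free_gen p S x) \<otimes>\<^bsub>N2p_presented p S R\<^esub> h)"
    and inv_gen: "\<And>x h. x \<in> S \<Longrightarrow> h \<in> carrier (N2p_presented p S R) \<Longrightarrow> P h \<Longrightarrow>
      P (inv\<^bsub>N2p_presented p S R\<^esub> presented_class p S R (N2p_free_gen p S x)
        \<otimes>\<^bsub>N2p_presented p S R\<^esub> h)"
  shows "P h"
proof -
  obtain a where a: "a \<in> carrier (N2p_free_group p S)" "h = presented_class p S R a"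
    using assms(1) presented_class_surj by blast
  from a(1) have "P (presented_class p S R a)"
  proof (induction a rule: N2p_free_group_induct)
    case one
    then show ?case using \<open>P \<one>\<^bsub>N2p_presented p S R\<^esub>\<close> by simp
  next
    case (gen x b)
    then show ?case
      using assms(3)[OF gen(1) q.hom_closed[OF gen(2)] gen(3)] by (simp add: N2p_free_gen_closed)
  next
    case (inv_gen x b)
    then show ?case
      using assms(4)[OF inv_gen(1) q.hom_closed[OF inv_gen(2)] inv_gen(3)] by (simp add: N2p_free_gen_closed)
  qed
  with a(2) show ?thesis by simp
qed

end

section \<open>Normal forms\<close>

definition heis_elem :: "nat \<Rightarrow> int \<Rightarrow> int \<Rightarrow> int \<Rightarrow> int \<times> int \<times> int" where
  "heis_elem p a b c = (a mod int p, b mod int p, c mod int p)"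

text \<open>The triple \<open>(a, b, c)\<close> stands for \<open>x\<^sup>a y\<^sup>b z\<^sup>c\<close> with \<open>z = [x, y]\<close>.\<close>

definition heis :: "nat \<Rightarrow> (int \<times> int \<times> int) monoid" where
  "heis p = \<lparr>carrier = {heis_elem p a b c | a b c. True},
     monoid.mult = (\<lambda>(a, b, c) (a', b', c'). heis_elem p (a + a') (b + b') (c + c' - b * a')),
     one = heis_elem p 0 0 0\<rparr>"

lemma heis_elem_closed [simp]: "heis_elem p a b c \<in> carrier (heis p)"
  by (auto simp: heis_def)

lemma heis_elem_cases:
  assumes "h \<in> carrier (heis p)"
  obtains a b c where "h = heis_elem p a b c"
  using assms by (auto simp: heis_def)

text \<open>The operation is defined on reduced entries; this form admits arbitrary integer
  representatives, so that the group laws become integer identities.\<close>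

lemma heis_mult [simp]:
  "heis_elem p a b c \<otimes>\<^bsub>heis p\<^esub> heis_elem p a' b' c' = heis_elem p (a + a') (b + b') (c + c' - b * a')"
proof -
  have "(c mod int p + c' mod int p - b mod int p * (a' mod int p)) mod int p = (c + c' - b * a') mod int p"
    by (intro mod_diff_cong) (simp_all add: mod_simps)
  then show ?thesis
    by (simp add: heis_def heis_elem_def mod_simps)
qed

lemma heis_one: "\<one>\<^bsub>heis p\<^esub> = heis_elem p 0 0 0"
  by (simp add: heis_def)

lemma heis_elem_eq_iff:
  "heis_elem p a b c = heis_elem p a' b' c' \<longleftrightarrow>
     a mod int p = a' mod int p \<and> b mod int p = b' mod int p \<and> c mod int p = c' mod int p"
  by (simp add: heis_elem_def)

lemma group_heis: "group (heis p)"
proof (rule groupI)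
  fix h assume "h \<in> carrier (heis p)"
  then obtain a b c where "h = heis_elem p a b c" by (rule heis_elem_cases)
  \<comment> \<open>The term \<open>- a * b\<close> compensates the twist in the third entry of the
    product.\<close>
  then have "heis_elem p (- a) (- b) (- c - a * b) \<otimes>\<^bsub>heis p\<^esub> h = \<one>\<^bsub>heis p\<^esub>"
    by (simp add: heis_one algebra_simps)
  then show "\<exists>y\<in>carrier (heis p). y \<otimes>\<^bsub>heis p\<^esub> h = \<one>\<^bsub>heis p\<^esub>"
    using heis_elem_closed by blast
qed (auto elim!: heis_elem_cases simp: heis_one algebra_simps)

text \<open>Passing from the n-th power to the next adds the twist -(n b) a; summing these over the
  steps gives the binomial coefficient.\<close>

lemma heis_pow:
  "heis_elem p a b c [^]\<^bsub>heis p\<^esub> (n :: nat) =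
     heis_elem p (int n * a) (int n * b) (int n * c - int (n choose 2) * (a * b))"
proof (induction n)
  case 0
  then show ?case by (simp add: heis_one numeral_2_eq_2)
next
  case (Suc n)
  have "Suc n choose 2 = n + (n choose 2)"
    by (simp add: numeral_2_eq_2)
  then show ?case
    using Suc by (simp add: algebra_simps)
qed

text \<open>The third entry is the determinant of the two leading pairs. A commutator has leading
  pair zero, so a further commutator with it is trivial.\<close>

lemma heis_commutator:
  "commutator (heis p) (heis_elem p a b c) (heis_elem p a' b' c') = heis_elem p 0 0 (a * b' - b * a')"
  by (subst group.commutator_eq_iff[OF group_heis]) (simp_all add: algebra_simps)

lemma in_N2p_heis:
  assumes "prime p" and "odd p"
  shows "in_N2p p (heis p)"
  unfolding in_N2p_def
proof (intro conjI ballI group_heis)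
  \<comment> \<open>For p = 2 the exponent law fails: \<open>heis_elem 2 1 1 0\<close> has order 4.
    For 2 < p the binomial coefficient in \<open>heis_pow\<close> is divisible by p.\<close>
  have "2 < p"
    using assms prime_ge_2_nat[of p] by (cases "p = 2") auto
  then have "p dvd (p choose 2)"
    using assms by (intro dvd_choose_prime) auto
  then have "int p dvd int (p choose 2)" by simp
  then have "heis_elem p a b c [^]\<^bsub>heis p\<^esub> p = \<one>\<^bsub>heis p\<^esub>" for a b c
    by (simp add: heis_pow heis_one heis_elem_eq_iff mod_0_imp_dvd dvd_imp_mod_0)
  then show "h [^]\<^bsub>heis p\<^esub> p = \<one>\<^bsub>heis p\<^esub>" if "h \<in> carrier (heis p)" for h
    using that by (auto elim: heis_elem_cases)
  show "commutator (heis p) (commutator (heis p) h h') h'' = \<one>\<^bsub>heis p\<^esub>"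
    if "h \<in> carrier (heis p)" "h' \<in> carrier (heis p)" "h'' \<in> carrier (heis p)" for h h' h''
    using that by (auto elim!: heis_elem_cases simp: heis_commutator heis_one)
qed

text \<open>Under the homomorphism given by \<open>heis_x p k\<close> and \<open>heis_z p k\<close>, the image of
  \<open>\<Prod>\<^sub>i x\<^sub>i\<^sup>a\<^sup>i z\<^sub>i\<^sup>b\<^sup>i\<close> has the entries \<open>\<Sum>\<^sub>i\<^sub><\<^sub>k a\<^sub>i\<close>, \<open>a\<^sub>k\<close> and \<open>b\<^sub>k\<close>:
  these homomorphisms separate normal forms and read off the digits of a product.\<close>

definition heis_x :: "nat \<Rightarrow> nat \<Rightarrow> nat \<Rightarrow> int \<times> int \<times> int" where
  "heis_x p k i = (if i < k then heis_elem p 1 0 0 else if i = k then heis_elem p 0 1 0 else heis_elem p 0 0 0)"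

definition heis_z :: "nat \<Rightarrow> nat \<Rightarrow> nat \<Rightarrow> int \<times> int \<times> int" where
  "heis_z p k i = (if i = k then heis_elem p 0 0 1 else heis_elem p 0 0 0)"

lemma heis_xz_closed [simp]: "heis_x p k i \<in> carrier (heis p)" "heis_z p k i \<in> carrier (heis p)"
  by (simp_all add: heis_x_def heis_z_def)

text \<open>For j < k both images are x and commute; for j > k the second is 1; for j = k they are x
  and y whatever i is. This matches relations whose right side depends only on the larger
  index.\<close>

lemma commutator_heis_x: "i < j \<Longrightarrow> commutator (heis p) (heis_x p k i) (heis_x p k j) = heis_z p k j"
  by (auto simp: heis_x_def heis_z_def heis_commutator)

text \<open>These hypotheses are what the coding by digits uses of the group. Generation needs no
  inverses, because they are powers under the exponent law. The condition \<open>0 < k\<close>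
  excludes a contradiction for p > 1: \<open>heis_z p 0 0\<close> is the nontrivial central z,
  whereas \<open>z 0\<close> is 1.\<close>

locale normal_form = group G for G (structure) +
  fixes p :: nat and x z :: "nat \<Rightarrow> 'a" and \<phi> :: "nat \<Rightarrow> 'a \<Rightarrow> int \<times> int \<times> int"
  assumes p_pos: "0 < p"
    and in_N2p: "in_N2p p G"
    and x_closed [simp]: "x i \<in> carrier G"
    and z_closed [simp]: "z i \<in> carrier G"
    and z_0 [simp]: "z 0 = \<one>"
    and x_commutator: "i < k \<Longrightarrow> commutator G (x i) (x k) = z k"
    and generated: "\<lbrakk>\<one> \<in> A; \<And>i h. h \<in> A \<Longrightarrow> h \<in> carrier G \<Longrightarrow> x i \<otimes> h \<in> A;
      \<And>i h. h \<in> A \<Longrightarrow> h \<in> carrier G \<Longrightarrow> z i \<otimes> h \<in> A\<rbrakk> \<Longrightarrow> carrier G \<subseteq> A"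
    and \<phi>_hom: "0 < k \<Longrightarrow> \<phi> k \<in> hom G (heis p)"
    and \<phi>_x: "0 < k \<Longrightarrow> \<phi> k (x i) = heis_x p k i"
    and \<phi>_z: "0 < k \<Longrightarrow> \<phi> k (z i) = heis_z p k i"
begin

lemma pow_p: "h \<in> carrier G \<Longrightarrow> h [^] p = \<one>"
  using in_N2p by (simp add: in_N2p_def)

lemma pow_mod:
  assumes "h \<in> carrier G"
  shows "h [^] n = h [^] (n mod p)"
proof -
  have "h [^] n = h [^] (p * (n div p) + n mod p)" by simp
  also have "\<dots> = h [^] (n mod p)"
    using assms by (simp only: nat_pow_mult[symmetric] nat_pow_pow[symmetric])
      (simp add: pow_p)
  finally show ?thesis .
qed

text \<open>For i > 0 the element z_i is the commutator of x_0 and x_i, and the first law makes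
  commutators central.\<close>

lemma z_central:
  assumes "h \<in> carrier G"
  shows "z i \<otimes> h = h \<otimes> z i"
proof (cases "i = 0")
  case False
  then have "z i = commutator G (x 0) (x i)" by (simp add: x_commutator)
  then have "commutator G (z i) h = \<one>"
    using in_N2p assms by (simp add: in_N2p_def)
  then show ?thesis using assms by (simp add: commutator_eq_iff)
qed (use assms in simp)

lemma z_pow_central:
  assumes "h \<in> carrier G"
  shows "z i [^] (n :: nat) \<otimes> h = h \<otimes> z i [^] n"
  using assms by (induction n) (simp_all add: m_assoc z_central, simp add: m_assoc[symmetric])

text \<open>Exponents are natural numbers, so \<open>(p - 1) * a\<close> stands for -a. Each x_j
  that x_m passes costs one inverse of z_m.\<close>

lemma x_past_x:
  assumes "j < m"
  shows "x m \<otimes> x j [^] (a :: nat) = x j [^] a \<otimes> x m \<otimes> z m [^] ((p - 1) * a)"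
proof (induction a)
  case (Suc a)
  have "x j \<otimes> x m = x m \<otimes> x j \<otimes> z m"
    using x_commutator[OF assms] by (simp add: commutator_eq_iff)
  then have "x j \<otimes> x m \<otimes> z m [^] (p - 1) = x m \<otimes> x j \<otimes> (z m \<otimes> z m [^] (p - 1))"
    by (simp add: m_assoc)
  also have "z m \<otimes> z m [^] (p - 1) = \<one>"
    using p_pos pow_p[of "z m"] nat_pow_Suc2[of "z m" "p - 1"] by simp
  finally have swap: "x m \<otimes> x j = x j \<otimes> x m \<otimes> z m [^] (p - 1)" by simp
  have "x m \<otimes> x j [^] Suc a = (x m \<otimes> x j [^] a) \<otimes> x j" by (simp add: m_assoc)
  also have "\<dots> = x j [^] a \<otimes> x m \<otimes> (z m [^] ((p - 1) * a) \<otimes> x j)" by (simp add: Suc m_assoc)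
  also have "\<dots> = x j [^] a \<otimes> (x m \<otimes> x j) \<otimes> z m [^] ((p - 1) * a)"
    by (simp add: z_pow_central m_assoc)
  also have "\<dots> = x j [^] Suc a \<otimes> x m \<otimes> (z m [^] (p - 1) \<otimes> z m [^] ((p - 1) * a))"
    by (simp add: swap m_assoc)
  also have "z m [^] (p - 1) \<otimes> z m [^] ((p - 1) * a) = z m [^] ((p - 1) * Suc a)"
    by (simp add: nat_pow_mult)
  finally show ?case .
qed simp

text \<open>The central z_n could stand anywhere; next to x_n, both digits belong to the same
  position of a string.\<close>

primrec nform :: "nat \<Rightarrow> (nat \<Rightarrow> nat) \<Rightarrow> (nat \<Rightarrow> nat) \<Rightarrow> 'a" where
  "nform 0 a b = \<one>"
| "nform (Suc n) a b = nform n a b \<otimes> x n [^] a n \<otimes> z n [^] b n"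

lemma nform_closed [simp]: "nform n a b \<in> carrier G"
  by (induction n) simp_all

lemma nform_cong:
  assumes "\<And>i. i < n \<Longrightarrow> a i mod p = a' i mod p"
    and "\<And>i. 0 < i \<Longrightarrow> i < n \<Longrightarrow> b i mod p = b' i mod p"
  shows "nform n a b = nform n a' b'"
  using assms
proof (induction n)
  case (Suc n)
  have "x n [^] a n = x n [^] a' n"
    using Suc.prems(1)[of n] pow_mod[of "x n" "a n"] pow_mod[of "x n" "a' n"] by simp
  moreover have "z n [^] b n = z n [^] b' n"
    using Suc.prems(2)[of n] pow_mod[of "z n" "b n"] pow_mod[of "z n" "b' n"] by (cases "n = 0") simp_all
  ultimately show ?case using Suc by simp
qed simp

lemma nform_extend:
  assumes "n \<le> m" and "\<And>i. n \<le> i \<Longrightarrow> a i = 0 \<and> b i = 0"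
  shows "nform m a b = nform n a b"
  using assms(1) by (induction m rule: dec_induct) (simp_all add: assms(2))

lemma x_past_nform:
  "n \<le> m \<Longrightarrow> x m \<otimes> nform n a b = nform n a b \<otimes> x m \<otimes> z m [^] ((p - 1) * (\<Sum>j<n. a j))"
proof (induction n)
  case (Suc n)
  let ?s = "(p - 1) * (\<Sum>j<n. a j)"
  have "x m \<otimes> nform (Suc n) a b = (x m \<otimes> nform n a b) \<otimes> x n [^] a n \<otimes> z n [^] b n"
    by (simp add: m_assoc)
  also have "\<dots> = nform n a b \<otimes> x m \<otimes> (z m [^] ?s \<otimes> (x n [^] a n \<otimes> z n [^] b n))"
    using Suc by (simp add: m_assoc)
  also have "\<dots> = nform n a b \<otimes> (x m \<otimes> x n [^] a n) \<otimes> (z n [^] b n \<otimes> z m [^] ?s)"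
    by (subst z_pow_central) (simp_all add: m_assoc)
  also have "\<dots> = nform n a b \<otimes> x n [^] a n \<otimes> (x m \<otimes> (z m [^] ((p - 1) * a n) \<otimes> z n [^] b n)) \<otimes> z m [^] ?s"
    using Suc.prems by (simp add: x_past_x m_assoc)
  also have "x m \<otimes> (z m [^] ((p - 1) * a n) \<otimes> z n [^] b n) = z n [^] b n \<otimes> x m \<otimes> z m [^] ((p - 1) * a n)"
    by (simp add: z_pow_central[of _ n] m_assoc)
  also have "nform n a b \<otimes> x n [^] a n \<otimes> (z n [^] b n \<otimes> x m \<otimes> z m [^] ((p - 1) * a n)) \<otimes> z m [^] ?s
      = nform (Suc n) a b \<otimes> x m \<otimes> (z m [^] ((p - 1) * a n) \<otimes> z m [^] ?s)"
    by (simp add: m_assoc)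
  also have "z m [^] ((p - 1) * a n) \<otimes> z m [^] ?s = z m [^] ((p - 1) * (\<Sum>j<Suc n. a j))"
    by (simp add: nat_pow_mult algebra_simps)
  finally show ?case .
qed simp

text \<open>The new factor passes all x_j with j < i and merges with the power of x_i. Every
  commutator arising on the way is a power of z_i, since the larger index decides, so all other
  positions keep their digits.\<close>

lemma x_nform:
  "i < n \<Longrightarrow> x i \<otimes> nform n a b =
     nform n (a(i := Suc (a i))) (b(i := b i + (p - 1) * (\<Sum>j<i. a j)))"
proof (induction n)
  case (Suc n)
  let ?a = "a(i := Suc (a i))" and ?b = "b(i := b i + (p - 1) * (\<Sum>j<i. a j))"
  have split: "x i \<otimes> nform (Suc n) a b = (x i \<otimes> nform n a b) \<otimes> x n [^] a n \<otimes> z n [^] b n"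
    by (simp add: m_assoc)
  show ?case
  proof (cases "i = n")
    case True
    let ?s = "(p - 1) * (\<Sum>j<n. a j)"
    have "x n \<otimes> nform (Suc n) a b = nform n a b \<otimes> x n \<otimes> (z n [^] ?s \<otimes> x n [^] a n) \<otimes> z n [^] b n"
      using split True by (simp add: x_past_nform m_assoc)
    also have "\<dots> = nform n a b \<otimes> (x n \<otimes> x n [^] a n) \<otimes> (z n [^] ?s \<otimes> z n [^] b n)"
      by (subst z_pow_central) (simp_all add: m_assoc)
    also have "x n \<otimes> x n [^] a n = x n [^] Suc (a n)"
      by (simp only: nat_pow_Suc2 x_closed)
    also have "z n [^] ?s \<otimes> z n [^] b n = z n [^] (b n + ?s)"
      by (simp add: nat_pow_mult add.commute)
    also have "nform n a b = nform n (a(n := Suc (a n))) (b(n := b n + ?s))"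
      by (intro nform_cong) auto
    finally show ?thesis unfolding True nform.simps by (simp del: nat_pow_Suc)
  next
    case False
    then have "i < n" using Suc.prems by simp
    then have "x i \<otimes> nform n a b = nform n ?a ?b" by (rule Suc.IH)
    then have "x i \<otimes> nform (Suc n) a b = nform n ?a ?b \<otimes> x n [^] a n \<otimes> z n [^] b n"
      using split by (simp only:)
    then show ?thesis unfolding nform.simps using False by simp
  qed
qed simp

lemma z_nform:
  "i < n \<Longrightarrow> z i \<otimes> nform n a b = nform n a (b(i := Suc (b i)))"
proof (induction n)
  case (Suc n)
  show ?case
  proof (cases "i = n")
    case True
    have "z n \<otimes> nform (Suc n) a b = nform n a b \<otimes> x n [^] a n \<otimes> z n [^] Suc (b n)"
      by (simp add: z_central m_assoc)
    also have "nform n a b = nform n a (b(n := Suc (b n)))"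
      by (intro nform_cong) auto
    finally show ?thesis unfolding True nform.simps by simp
  next
    case False
    have "z i \<otimes> nform (Suc n) a b = (z i \<otimes> nform n a b) \<otimes> x n [^] a n \<otimes> z n [^] b n"
      by (simp add: m_assoc)
    then show ?thesis using False Suc by simp
  qed
qed simp

text \<open>Demanding equality with all sufficiently long normal forms frees the digits from a
  chosen length: elements given by strings of different lengths can be compared, and
  \<open>\<phi> k\<close> evaluated for every k > 0.\<close>

definition has_digits :: "'a \<Rightarrow> (nat \<Rightarrow> nat) \<Rightarrow> (nat \<Rightarrow> nat) \<Rightarrow> bool" where
  "has_digits h a b \<longleftrightarrow> (\<exists>N. \<forall>n\<ge>N. h = nform n a b)"

lemma has_digits_nform:
  assumes "\<And>i. n \<le> i \<Longrightarrow> a i = 0 \<and> b i = 0"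
  shows "has_digits (nform n a b) a b"
  unfolding has_digits_def
proof (intro exI allI impI)
  fix m assume "n \<le> m"
  then show "nform n a b = nform m a b"
    using assms by (intro nform_extend[symmetric])
qed

lemma digits_exist:
  assumes "h \<in> carrier G"
  obtains n a b where "h = nform n a b" and "\<And>i. n \<le> i \<Longrightarrow> a i = 0 \<and> b i = 0"
proof -
  define A where "A = {nform n a b | n a b. True}"
  \<comment> \<open>A generator of index i acts digitwise only on normal forms longer than i. The
    digits from n on are arbitrary, so they are set to 0 before lengthening.\<close>
  have widen: "\<exists>n>i. \<exists>a b. h = nform n a b" if "h \<in> A" for h i
  proof -
    obtain n a b where h: "h = nform n a b" using \<open>h \<in> A\<close> unfolding A_def by blast
    let ?a = "\<lambda>j. if j < n then a j else 0" and ?b = "\<lambda>j. if j < n then b j else 0"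
    have "h = nform n ?a ?b" unfolding h by (rule nform_cong) auto
    also have "\<dots> = nform (max n (Suc i)) ?a ?b" by (rule nform_extend[symmetric]) auto
    finally show ?thesis by (intro exI[of _ "max n (Suc i)"] conjI exI) auto
  qed
  have nform_A: "nform n a b \<in> A" for n a b
    unfolding A_def by blast
  have "carrier G \<subseteq> A"
  proof (rule generated)
    show "\<one> \<in> A" using nform_A[of 0] by simp
    show "x i \<otimes> h \<in> A" if h: "h \<in> A" for i h
      using widen[OF h, of i] by (auto simp: x_nform nform_A)
    show "z i \<otimes> h \<in> A" if h: "h \<in> A" for i h
      using widen[OF h, of i] by (auto simp: z_nform nform_A)
  qed
  then obtain n a b where h: "h = nform n a b" using assms unfolding A_def by blast
  show thesis
  proof
    show "h = nform n (\<lambda>j. if j < n then a j else 0) (\<lambda>j. if j < n then b j else 0)"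
      unfolding h by (rule nform_cong) auto
  qed auto
qed

text \<open>Factors below k become powers of x, whose exponents add without twist; position k
  contributes the powers of y and z; factors above k become trivial.\<close>

lemma \<phi>_nform:
  assumes "0 < k" and "k < n"
  shows "\<phi> k (nform n a b) = heis_elem p (int (\<Sum>i<k. a i)) (int (a k)) (int (b k))"
proof -
  interpret H: group "heis p" by (rule group_heis)
  interpret \<phi>: group_hom G "heis p" "\<phi> k"
    by unfold_locales (rule \<phi>_hom[OF assms(1)])
  have low: "\<phi> k (nform m a b) = heis_elem p (int (\<Sum>i<m. a i)) 0 0" if "m \<le> k" for m
    using that
  proof (induction m)
    case 0
    then show ?case by (simp add: heis_one)
  next
    case (Suc m)
    then show ?case
      by (simp add: \<phi>.hom_nat_pow \<phi>_x \<phi>_z assms(1) heis_x_def heis_z_def heis_pow)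
  qed
  from assms(2) have "Suc k \<le> n" by simp
  then show ?thesis
  proof (induction n rule: dec_induct)
    case base
    then show ?case
      by (simp add: \<phi>.hom_nat_pow \<phi>_x \<phi>_z assms(1) heis_x_def heis_z_def heis_pow low)
  next
    case (step n)
    then show ?case
      by (simp add: \<phi>.hom_nat_pow \<phi>_x \<phi>_z assms(1) heis_x_def heis_z_def heis_pow)
  qed
qed

lemma \<phi>_has_digits:
  assumes "0 < k" and "has_digits h a b"
  shows "\<phi> k h = heis_elem p (int (\<Sum>i<k. a i)) (int (a k)) (int (b k))"
proof -
  obtain N where "\<And>n. N \<le> n \<Longrightarrow> h = nform n a b"
    using assms(2) unfolding has_digits_def by blast
  then have "h = nform (max N (Suc k)) a b" by simp
  then show ?thesis using \<phi>_nform[OF assms(1), of "max N (Suc k)"] by simp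
qed

lemma eq_iff_digits:
  assumes h: "has_digits h a b" and h': "has_digits h' a' b'"
  shows "h = h' \<longleftrightarrow> (\<forall>i. a i mod p = a' i mod p \<and> (0 < i \<longrightarrow> b i mod p = b' i mod p))"
proof
  assume "h = h'"
  then have eq: "heis_elem p (int (\<Sum>i<k. a i)) (int (a k)) (int (b k)) =
      heis_elem p (int (\<Sum>i<k. a' i)) (int (a' k)) (int (b' k))" if "0 < k" for k
    using \<phi>_has_digits[OF that h] \<phi>_has_digits[OF that h'] by simp
  \<comment> \<open>For no k > 0 is a_0 the second entry; for k = 1 it is the whole sum in the
    first.\<close>
  have "int (a 0) mod int p = int (a' 0) mod int p"
    using eq[of 1] by (simp add: heis_elem_eq_iff)
  then have "a i mod p = a' i mod p" for i
    using eq[of i] by (cases "i = 0") (simp_all add: heis_elem_eq_iff flip: of_nat_mod)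
  moreover have "b i mod p = b' i mod p" if "0 < i" for i
    using eq[OF that] by (simp add: heis_elem_eq_iff flip: of_nat_mod)
  ultimately show "\<forall>i. a i mod p = a' i mod p \<and> (0 < i \<longrightarrow> b i mod p = b' i mod p)"
    by blast
next
  assume dig: "\<forall>i. a i mod p = a' i mod p \<and> (0 < i \<longrightarrow> b i mod p = b' i mod p)"
  obtain N N' where "\<And>n. N \<le> n \<Longrightarrow> h = nform n a b" "\<And>n. N' \<le> n \<Longrightarrow> h' = nform n a' b'"
    using h h' unfolding has_digits_def by blast
  then have "h = nform (max N N') a b" "h' = nform (max N N') a' b'" by simp_all
  moreover have "nform (max N N') a b = nform (max N N') a' b'"
    using dig by (intro nform_cong) auto
  ultimately show "h = h'" by simp
qed

text \<open>The product has some digits by \<open>digits_exist\<close>, and its images in the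
  Heisenberg group identify them modulo p. The twist of that multiplication supplies the term with
  the partial sum.\<close>

lemma mult_eq_iff_digits:
  assumes h1: "has_digits h1 a1 b1" and h2: "has_digits h2 a2 b2" and h3: "has_digits h3 a3 b3"
    and closed: "h1 \<in> carrier G" "h2 \<in> carrier G"
  shows "h1 \<otimes> h2 = h3 \<longleftrightarrow> (\<forall>i. (int (a1 i) + int (a2 i)) mod int p = int (a3 i) mod int p \<and>
    (0 < i \<longrightarrow> (int (b1 i) + int (b2 i) - int (a1 i) * int (\<Sum>j<i. a2 j)) mod int p = int (b3 i) mod int p))"
proof -
  obtain n a b where h: "h1 \<otimes> h2 = nform n a b" and 0: "\<And>i. n \<le> i \<Longrightarrow> a i = 0 \<and> b i = 0"
    using digits_exist[of "h1 \<otimes> h2"] closed by auto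
  have dig: "has_digits (h1 \<otimes> h2) a b"
    unfolding h using 0 by (rule has_digits_nform)
  have eq: "heis_elem p (int (\<Sum>i<k. a i)) (int (a k)) (int (b k)) =
    heis_elem p (int (\<Sum>i<k. a1 i) + int (\<Sum>i<k. a2 i)) (int (a1 k) + int (a2 k))
      (int (b1 k) + int (b2 k) - int (a1 k) * int (\<Sum>j<k. a2 j))" if "0 < k" for k
    using \<phi>_has_digits[OF that dig] \<phi>_has_digits[OF that h1] \<phi>_has_digits[OF that h2]
      hom_mult[OF \<phi>_hom[OF that] closed] by simp
  have "int (a 0) mod int p = (int (a1 0) + int (a2 0)) mod int p"
    using eq[of 1] by (simp add: heis_elem_eq_iff)
  then have a: "int (a i) mod int p = (int (a1 i) + int (a2 i)) mod int p" for i
    using eq[of i] by (cases "i = 0") (simp_all add: heis_elem_eq_iff)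
  have b: "int (b i) mod int p = (int (b1 i) + int (b2 i) - int (a1 i) * int (\<Sum>j<i. a2 j)) mod int p"
    if "0 < i" for i
    using eq[OF that] by (simp add: heis_elem_eq_iff)
  have nat_int: "m mod p = n mod p \<longleftrightarrow> int m mod int p = int n mod int p" for m n
    by (simp flip: of_nat_mod)
  show ?thesis
    unfolding eq_iff_digits[OF dig h3] nat_int using a b by metis
qed

end

section \<open>The automata\<close>

text \<open>The letter \<open>a + p b\<close> at position \<open>i\<close> stands for \<open>x\<^sub>i\<^sup>a z\<^sub>i\<^sup>b\<close>; the filler symbol counts as \<open>0\<close>.\<close>

definition letter :: "nat option \<Rightarrow> nat" where
  "letter c = (case c of None \<Rightarrow> 0 | Some l \<Rightarrow> l)"

definition letter_at :: "nat list \<Rightarrow> nat \<Rightarrow> nat" where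
  "letter_at w i = (if i < length w then w ! i else 0)"

definition x_digit :: "nat \<Rightarrow> nat list \<Rightarrow> nat \<Rightarrow> nat" where
  "x_digit p w i = letter_at w i mod p"

definition z_digit :: "nat \<Rightarrow> nat list \<Rightarrow> nat \<Rightarrow> nat" where
  "z_digit p w i = letter_at w i div p"

lemma letter_column: "i < length ws \<Longrightarrow> letter (column ws k ! i) = letter_at (ws ! i) k"
  by (simp add: letter_def letter_at_def column_def)

lemma letter_at_beyond: "max_length ws \<le> k \<Longrightarrow> i < length ws \<Longrightarrow> letter_at (ws ! i) k = 0"
  using less_max_length_iff[of k ws] by (auto simp: letter_at_def)

text \<open>The automaton sees only the columns of the convolution, while digits are indexed by all
  positions. Past the last column all digits are 0, and the conditions used below are trivial
  there.\<close>

lemma ball_less_max_length: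
  assumes "\<And>k. max_length ws \<le> k \<Longrightarrow> P k"
  shows "(\<forall>k<max_length ws. P k) \<longleftrightarrow> (\<forall>k. P k)"
  using assms by (metis not_le)

definition same_digits :: "nat \<Rightarrow> nat list \<Rightarrow> nat list \<Rightarrow> nat \<Rightarrow> bool" where
  "same_digits p s t k \<longleftrightarrow> x_digit p s k mod p = x_digit p t k mod p \<and>
     (0 < k \<longrightarrow> z_digit p s k mod p = z_digit p t k mod p)"

text \<open>The state only tells whether the current column is the first: the z-digit at position 0
  belongs to z_0 = 1 and is ignored.\<close>

lemma fa_recognizable_same_digits:
  "fa_recognizable \<Sigma> 2 {[s, t] | s t. s \<in> lists \<Sigma> \<and> t \<in> lists \<Sigma> \<and> (\<forall>k. same_digits p s t k)}"
proof -
  define ok where "ok q c \<longleftrightarrow> letter (c ! 0) mod p = letter (c ! 1) mod p \<and>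
      (q \<or> letter (c ! 0) div p mod p = letter (c ! 1) div p mod p)" for q c
  have state: "foldl (\<lambda>_ _. False) True (map (column ws) [0..<k]) = (k = 0)" for ws :: "nat list list" and k
    by (induction k) simp_all
  have "(\<forall>k<max_length [s, t]. ok (k = 0) (column [s, t] k)) \<longleftrightarrow> (\<forall>k. same_digits p s t k)" for s t
  proof -
    have "ok (k = 0) (column [s, t] k) \<longleftrightarrow> same_digits p s t k" for k
      by (auto simp: ok_def same_digits_def x_digit_def z_digit_def letter_column)
    moreover have "same_digits p s t k" if "max_length [s, t] \<le> k" for k
      using letter_at_beyond[OF that, of 0] letter_at_beyond[OF that, of 1]
      by (simp add: same_digits_def x_digit_def z_digit_def)
    ultimately show ?thesis by (simp add: ball_less_max_length)
  qed
  then have "{[s, t] | s t. s \<in> lists \<Sigma> \<and> t \<in> lists \<Sigma> \<and> (\<forall>k. same_digits p s t k)} =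
    {ws. length ws = 2 \<and> set ws \<subseteq> lists \<Sigma> \<and>
      (\<forall>k<max_length ws. ok (foldl (\<lambda>_ _. False) True (map (column ws) [0..<k])) (column ws k))}"
    unfolding state by (auto simp: length_Suc_conv numeral_2_eq_2)
  moreover have "fa_recognizable \<Sigma> 2 \<dots>"
    by (rule fa_recognizable_local_check[where Q = UNIV]) simp_all
  ultimately show ?thesis by simp
qed

definition product_digits :: "nat \<Rightarrow> nat list \<Rightarrow> nat list \<Rightarrow> nat list \<Rightarrow> nat \<Rightarrow> bool" where
  "product_digits p s t r k \<longleftrightarrow>
     (int (x_digit p s k) + int (x_digit p t k)) mod int p = int (x_digit p r k) mod int p \<and>
     (0 < k \<longrightarrow> (int (z_digit p s k) + int (z_digit p t k)
         - int (x_digit p s k) * int (\<Sum>j<k. x_digit p t j)) mod int p = int (z_digit p r k) mod int p)"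

text \<open>Besides the flag for the first column, the state holds the sum modulo p of the x-digits
  of the second string before the current column.\<close>

lemma fa_recognizable_product_digits:
  assumes "0 < p"
  shows "fa_recognizable \<Sigma> 3 {[s, t, r] | s t r. s \<in> lists \<Sigma> \<and> t \<in> lists \<Sigma> \<and> r \<in> lists \<Sigma> \<and>
    (\<forall>k. product_digits p s t r k)}"
proof -
  define \<delta> where "\<delta> q c = (False, (snd q + letter (c ! 1) mod p) mod p)" for q :: "bool \<times> nat" and c
  define ok where "ok q c \<longleftrightarrow>
      (int (letter (c ! 0) mod p) + int (letter (c ! 1) mod p)) mod int p = int (letter (c ! 2) mod p) mod int p \<and>
      (fst q \<or> (int (letter (c ! 0) div p) + int (letter (c ! 1) div p)
         - int (letter (c ! 0) mod p) * int (snd q)) mod int p = int (letter (c ! 2) div p) mod int p)"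
    for q :: "bool \<times> nat" and c
  have state: "foldl \<delta> (True, 0) (map (column [s, t, r]) [0..<k]) = (k = 0, (\<Sum>j<k. x_digit p t j) mod p)"
    for s t r k
    by (induction k) (simp_all add: \<delta>_def x_digit_def[symmetric] letter_column mod_add_left_eq)
  have "(\<forall>k<max_length [s, t, r]. ok (foldl \<delta> (True, 0) (map (column [s, t, r]) [0..<k])) (column [s, t, r] k))
      \<longleftrightarrow> (\<forall>k. product_digits p s t r k)" for s t r
  proof -
    have red: "(u - v * int (m mod p)) mod int p = (u - v * int m) mod int p" for u v m
      by (intro mod_diff_cong mod_mult_cong) (simp_all add: of_nat_mod)
    have "ok (k = 0, (\<Sum>j<k. x_digit p t j) mod p) (column [s, t, r] k) \<longleftrightarrow> product_digits p s t r k" for k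
      unfolding ok_def product_digits_def fst_conv snd_conv red
      by (auto simp: x_digit_def z_digit_def letter_column)
    \<comment> \<open>The partial sum for \<open>t\<close> need not vanish here, but it is
      multiplied by the x-digit of \<open>s\<close>, which is 0.\<close>
    moreover have "product_digits p s t r k" if "max_length [s, t, r] \<le> k" for k
      using letter_at_beyond[OF that, of 0] letter_at_beyond[OF that, of 1] letter_at_beyond[OF that, of 2]
      by (simp add: product_digits_def x_digit_def z_digit_def)
    ultimately show ?thesis unfolding state by (simp add: ball_less_max_length)
  qed
  then have "{[s, t, r] | s t r. s \<in> lists \<Sigma> \<and> t \<in> lists \<Sigma> \<and> r \<in> lists \<Sigma> \<and>
      (\<forall>k. product_digits p s t r k)} =
    {ws. length ws = 3 \<and> set ws \<subseteq> lists \<Sigma> \<and>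
      (\<forall>k<max_length ws. ok (foldl \<delta> (True, 0) (map (column ws) [0..<k])) (column ws k))}"
    by (auto simp: length_Suc_conv numeral_3_eq_3)
  moreover have "fa_recognizable \<Sigma> 3 \<dots>"
    using assms by (intro fa_recognizable_local_check[where Q = "UNIV \<times> {..<p}"]) (auto simp: \<delta>_def)
  ultimately show ?thesis by simp
qed

context normal_form
begin

text \<open>Not injective: zero letters may be appended, and the z-digit of the first letter has no
  effect. Hence equality of elements differs from equality of strings.\<close>

definition decode :: "nat list \<Rightarrow> 'a" where
  "decode w = nform (length w) (x_digit p w) (z_digit p w)"

lemma has_digits_decode: "has_digits (decode w) (x_digit p w) (z_digit p w)"
  unfolding decode_def by (rule has_digits_nform) (simp add: x_digit_def z_digit_def letter_at_def)

lemma decode_surj: "decode ` lists {..<p * p} = carrier G"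
proof (intro equalityI subsetI)
  fix h assume "h \<in> carrier G"
  then obtain n a b where h: "h = nform n a b"
    using digits_exist by metis
  define w where "w = map (\<lambda>i. a i mod p + p * (b i mod p)) [0..<n]"
  have "a i mod p + p * (b i mod p) < p * p" for i
  proof -
    have "Suc (b i mod p) \<le> p" using p_pos by (simp add: Suc_leI)
    then have "p * Suc (b i mod p) \<le> p * p" by (rule mult_le_mono2)
    moreover have "a i mod p < p" using p_pos by simp
    ultimately show ?thesis by simp
  qed
  then have "w \<in> lists {..<p * p}" by (auto simp: w_def)
  moreover have "h = decode w"
    unfolding h decode_def
    by (simp add: w_def) (rule nform_cong, use p_pos in \<open>simp_all add: x_digit_def z_digit_def letter_at_def w_def\<close>)
  ultimately show "h \<in> decode ` lists {..<p * p}" by blast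
qed (auto simp: decode_def)

theorem normal_form_word_automatic: "word_automatic G"
proof -
  have eq: "decode s = decode t \<longleftrightarrow> (\<forall>k. same_digits p s t k)" for s t
    unfolding same_digits_def by (rule eq_iff_digits[OF has_digits_decode has_digits_decode])
  have mult: "decode s \<otimes> decode t = decode r \<longleftrightarrow> (\<forall>k. product_digits p s t r k)" for s t r
    unfolding product_digits_def
    by (rule mult_eq_iff_digits[OF has_digits_decode has_digits_decode has_digits_decode])
      (simp_all add: decode_def)
  show ?thesis
    unfolding word_automatic_def
  proof (intro conjI exI)
    show "group G" by (rule group_axioms)
    show "finite {..<p * p}" by simp
    show "regular {..<p * p} (lists {..<p * p})" by (rule regular_lists)
    show "decode ` lists {..<p * p} = carrier G" by (rule decode_surj)
    show "fa_recognizable {..<p * p} 2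
        {[s, t] | s t. s \<in> lists {..<p * p} \<and> t \<in> lists {..<p * p} \<and> decode s = decode t}"
      unfolding eq by (rule fa_recognizable_same_digits)
    show "fa_recognizable {..<p * p} 3 {[s, t, r] | s t r. s \<in> lists {..<p * p} \<and>
        t \<in> lists {..<p * p} \<and> r \<in> lists {..<p * p} \<and> decode s \<otimes> decode t = decode r}"
      unfolding mult by (rule fa_recognizable_product_digits[OF p_pos])
  qed
qed

end

section \<open>The group given by the presentation\<close>

definition H_relations where
  "H_relations p = {(commutator (N2p_free_group p H_gens)
         (N2p_free_gen p H_gens (Xgen i)) (N2p_free_gen p H_gens (Xgen k)),
       N2p_free_gen p H_gens (Zgen k)) | i k. i < k}"

lemma H_group_eq: "H_group p = N2p_presented p H_gens (H_relations p)"
  by (simp add: H_group_def H_relations_def)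

lemma Xgen_H_gens [simp]: "Xgen i \<in> H_gens"
  by (simp add: H_gens_def)

lemma Zgen_H_gens [simp]: "Zgen k \<in> H_gens \<longleftrightarrow> 0 < k"
  by (auto simp: H_gens_def)

text \<open>A relation with i < k has k > 0, so \<open>Zgen k\<close> is indeed a generator.\<close>

lemma H_relations_closed:
  "H_relations p \<subseteq> carrier (N2p_free_group p H_gens) \<times> carrier (N2p_free_group p H_gens)"
proof -
  interpret group "N2p_free_group p H_gens"
    using in_N2p_N2p_free_group[of p H_gens] by (simp add: in_N2p_def)
  show ?thesis
    by (auto simp: H_relations_def N2p_free_gen_closed)
qed

definition H_x where
  "H_x p i = presented_class p H_gens (H_relations p) (N2p_free_gen p H_gens (Xgen i))"

definition H_z where
  "H_z p k = (if k = 0 then \<one>\<^bsub>H_group p\<^esub>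
     else presented_class p H_gens (H_relations p) (N2p_free_gen p H_gens (Zgen k)))"

text \<open>The assignment to generators respects the relations by \<open>commutator_heis_x\<close>,
  so it extends to the relatively free group and descends to the presented one.\<close>

lemma H_group_hom_heis:
  assumes "prime p" and "odd p" and k: "0 < k"
  shows "\<exists>\<phi>\<in>hom (H_group p) (heis p). (\<forall>i. \<phi> (H_x p i) = heis_x p k i) \<and> (\<forall>i. \<phi> (H_z p i) = heis_z p k i)"
proof -
  note heis = in_N2p_heis[OF assms(1,2)]
  define f where "f g = (case g of Xgen i \<Rightarrow> heis_x p k i | Zgen i \<Rightarrow> heis_z p k i)" for g
  have f: "f g \<in> carrier (heis p)" if "g \<in> H_gens" for g
    by (simp add: f_def split: generator.split)
  obtain h where h: "h \<in> hom (N2p_free_group p H_gens) (heis p)"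
    "\<And>g. g \<in> H_gens \<Longrightarrow> h (N2p_free_gen p H_gens g) = f g"
    using N2p_free_group_universal[where f = f and S = H_gens, OF heis f] by blast
  interpret h: group_hom "N2p_free_group p H_gens" "heis p" h
    using in_N2p_N2p_free_group[of p H_gens] h(1)
    by (auto simp: in_N2p_def group_heis group_hom_def group_hom_axioms_def)
  have rel: "h u = h v" if "(u, v) \<in> H_relations p" for u v
    using that by (auto simp: H_relations_def h.hom_commutator N2p_free_gen_closed h(2) f_def commutator_heis_x)
  obtain g where g: "g \<in> hom (H_group p) (heis p)"
    "\<And>u. u \<in> carrier (N2p_free_group p H_gens) \<Longrightarrow> g (presented_class p H_gens (H_relations p) u) = h u"
    using N2p_presented_universal[OF H_relations_closed heis h(1) rel] unfolding H_group_eq by blast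
  have "group (H_group p)"
    using in_N2p_N2p_presented[OF H_relations_closed[of p]] by (simp add: H_group_eq in_N2p_def)
  \<comment> \<open>This treats index 0, where \<open>H_z p 0\<close> is 1 and
    \<open>heis_z p k 0\<close> is trivial because k > 0.\<close>
  then have "g \<one>\<^bsub>H_group p\<^esub> = \<one>\<^bsub>heis p\<^esub>"
    using g(1) group_heis hom_one by blast
  then show ?thesis
    using k by (intro bexI[OF _ g(1)])
      (auto simp: H_x_def H_z_def g(2) N2p_free_gen_closed h(2) f_def heis_z_def heis_one)
qed

theorem proposition5p2:
  fixes p :: nat
  assumes "prime p" and "odd p"
  shows "word_automatic (H_group p)"
proof -
  note closed = H_relations_closed[of p]
  have N2p: "in_N2p p (H_group p)"
    unfolding H_group_eq by (rule in_N2p_N2p_presented[OF closed])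
  interpret H: group "H_group p"
    using N2p by (simp add: in_N2p_def)
  interpret q: group_hom "N2p_free_group p H_gens" "H_group p" "presented_class p H_gens (H_relations p)"
    unfolding H_group_eq by (rule group_hom_presented_class[OF closed])
  have p: "0 < p" using assms(1) prime_gt_0_nat by blast
  obtain \<phi> where \<phi>: "\<And>k. 0 < k \<Longrightarrow> \<phi> k \<in> hom (H_group p) (heis p) \<and>
      (\<forall>i. \<phi> k (H_x p i) = heis_x p k i) \<and> (\<forall>i. \<phi> k (H_z p i) = heis_z p k i)"
    using H_group_hom_heis[OF assms] by metis
  have x: "H_x p i \<in> carrier (H_group p)" for i
    by (simp add: H_x_def N2p_free_gen_closed)
  have z: "H_z p i \<in> carrier (H_group p)" for i
    by (simp add: H_z_def N2p_free_gen_closed)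
  interpret normal_form "H_group p" p "H_x p" "H_z p" \<phi>
  proof unfold_locales
    fix i k :: nat assume "i < k"
    then have "(commutator (N2p_free_group p H_gens)
         (N2p_free_gen p H_gens (Xgen i)) (N2p_free_gen p H_gens (Xgen k)),
       N2p_free_gen p H_gens (Zgen k)) \<in> H_relations p"
      by (auto simp: H_relations_def)
    from presented_class_relation[OF closed this] \<open>i < k\<close>
    show "commutator (H_group p) (H_x p i) (H_x p k) = H_z p k"
      by (simp add: H_x_def H_z_def q.hom_commutator N2p_free_gen_closed)
  next
    fix A
    assume one: "\<one>\<^bsub>H_group p\<^esub> \<in> A"
      and xA: "\<And>i h. h \<in> A \<Longrightarrow> h \<in> carrier (H_group p) \<Longrightarrow> H_x p i \<otimes>\<^bsub>H_group p\<^esub> h \<in> A"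
      and zA: "\<And>i h. h \<in> A \<Longrightarrow> h \<in> carrier (H_group p) \<Longrightarrow> H_z p i \<otimes>\<^bsub>H_group p\<^esub> h \<in> A"
    have gen: "presented_class p H_gens (H_relations p) (N2p_free_gen p H_gens g) \<in> carrier (H_group p)"
      if "g \<in> H_gens" for g
      using that by (simp add: N2p_free_gen_closed)
    have genA: "presented_class p H_gens (H_relations p) (N2p_free_gen p H_gens g) \<otimes>\<^bsub>H_group p\<^esub> h \<in> A"
      if "g \<in> H_gens" "h \<in> A" "h \<in> carrier (H_group p)" for g h
    proof (cases g)
      case (Xgen i)
      then show ?thesis using xA[OF that(2,3), of i] by (simp add: H_x_def)
    next
      case (Zgen i)
      then show ?thesis using zA[OF that(2,3), of i] that(1) by (simp add: H_z_def)
    qed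
    \<comment> \<open>Induction over the presented group also produces inverses of generators, but
      \<open>A\<close> is known to be closed only under the generators. Closure under powers bridges
      this, as the inverse is the power with exponent p - 1.\<close>
    have powA: "presented_class p H_gens (H_relations p) (N2p_free_gen p H_gens g) [^]\<^bsub>H_group p\<^esub> n
        \<otimes>\<^bsub>H_group p\<^esub> h \<in> A"
      if "g \<in> H_gens" "h \<in> A" "h \<in> carrier (H_group p)" for g h and n :: nat
      using that(2,3)
    proof (induction n arbitrary: h)
      case (Suc n)
      then show ?case
        using gen[OF that(1)] genA[OF that(1)] by (simp add: H.m_assoc)
    qed simp
    show "carrier (H_group p) \<subseteq> A"
    proof
      fix h assume "h \<in> carrier (H_group p)"
      then show "h \<in> A"
        unfolding H_group_eq
      proof (induction h rule: N2p_presented_induct[OF closed, consumes 1, case_names one gen inv_gen])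
        case one
        then show ?case using \<open>\<one>\<^bsub>H_group p\<^esub> \<in> A\<close> by (simp add: H_group_eq)
      next
        case (gen g h)
        then show ?case using genA[of g h] by (simp add: H_group_eq)
      next
        case (inv_gen g h)
        let ?y = "presented_class p H_gens (H_relations p) (N2p_free_gen p H_gens g)"
        have y: "?y \<in> carrier (H_group p)" using inv_gen(1) by (rule gen)
        have "?y [^]\<^bsub>H_group p\<^esub> (p - 1) \<otimes>\<^bsub>H_group p\<^esub> ?y = ?y [^]\<^bsub>H_group p\<^esub> p"
          using p H.nat_pow_Suc[of ?y "p - 1"] by simp
        also have "\<dots> = \<one>\<^bsub>H_group p\<^esub>" using N2p y by (simp add: in_N2p_def)
        finally have "inv\<^bsub>H_group p\<^esub> ?y = ?y [^]\<^bsub>H_group p\<^esub> (p - 1)"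
          using y by (intro H.inv_equality) simp_all
        then show ?case
          using powA[OF inv_gen(1), of h "p - 1"] inv_gen by (simp add: H_group_eq)
      qed
    qed
  qed (use p N2p x z \<phi> in \<open>auto simp: H_z_def\<close>)
  show ?thesis by (rule normal_form_word_automatic)
qed

end
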